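(* Let $\mathcal{G}$ be a connected edge-weighted graph with vertex weight $\mu$ (as in the context), and suppose its completion $\overline{\mathcal{G}}$ is weakly connected and compact. For $j=1,2$ let $\Omega(j)\subset\overline{\mathcal{G}}\setminus\mathcal{G}$ be compact, and assume that $\mu(N_R(\Omega(j)))<\infty$ for some $R>0$. If $\Omega(1)\neq\Omega(2)$, then the operators $\mathcal{L}_{\Omega(1),\mu}$ and $\mathcal{L}_{\Omega(2),\mu}$ have distinct domains.
   Context: Graphs. $\mathcal{G}$ is a simple graph with countable vertex set $\mathcal{V}$ and countable edge set $\mathcal{E}$; each vertex has at least one and at most finitely many incident edges. Each edge $[u,v]\in\mathcal{E}$ has a length $R(u,v)=R(v,u)\in(0,\infty)$; $C(u,v)=1/R(u,v)$ for edges and $C(u,v)=0$ otherwise. $u\sim v$ means $[u,v]\in\mathcal{E}$. Metric and completion. A finite path from $u$ to $v$ is a finite sequence of vertices $u=v_0,\dots,v_K=v$ with $[v_k,v_{k+1}]\in\mathcal{E}$. $\mathcal{G}$ is connected if any two vertices are joined by a finite path. $d(u,v)=\inf_\gamma\sum_k R(v_k,v_{k+1})$, the infimum over finite paths $\gamma$ from $u$ to $v$. As a metric space $\mathcal{G}$ is identified with its vertex set, and $\overline{\mathcal{G}}$ is the metric completion. Paths in the completion. A path is a sequence $\{v_k\}$ of vertices with $[v_k,v_{k+1}]\in\mathcal{E}$, indexed by a finite set, by the positive integers (a ray), or by the integers (a double ray). It goes from $u\in\overline{\mathcal{G}}$ to $v\in\overline{\mathcal{G}}$ if it starts at $u$ (or,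 when infinite in that direction, converges to $u$) and ends at $v$ (or, when infinite in that direction, converges to $v$). Weakly connected. $\overline{\mathcal{G}}$ is weakly connected if for every pair of distinct points $u,v\in\overline{\mathcal{G}}$ there is a finite set $W$ of edges such that every path from $u$ to $v$ contains an edge from $W$. Measure. $\mu:\mathcal{V}\to(0,\infty)$ is a vertex weight; $\mu(U)=\sum_{v\in U\cap\mathcal{V}}\mu(v)$ for $U\subset\overline{\mathcal{G}}$. $l^2(\mu)$ is the real Hilbert space of $f:\mathcal{V}\to\mathbb{R}$ with $\sum_v f(v)^2\mu(v)<\infty$ and inner product $\langle f,g\rangle_\mu=\sum_v f(v)g(v)\mu(v)$. Neighborhoods. $N_R(\Omega)=\{z\in\overline{\mathcal{G}}: d(z,\Omega)\le R\}$. Operators. $\mathbb{A}$ is the algebra of functions $\phi:\mathcal{V}\to\mathbb{R}$ such that $\phi(u)\neq\phi(v)$ for only finitely many edges $[u,v]$; such functions extend continuously to $\overline{\mathcal{G}}$. For closed $\Omega\subset\overline{\mathcal{G}}\setminus\mathcal{G}$, $\mathbb{A}_\Omega$ is the set of $\phi\in\mathbb{A}$ whose extension vanishes on $\Omega$, and $\mathcal{D}_\Omega=\mathbb{A}_\Omega\cap l^2(\mu)$. $S_{\Omega,\mu}$ is the operator on $l^2(\mu)$ with domain $\mathcal{D}_\Omega$ acting by $\Delta_\mu f(v)=\frac1{\mu(v)}\sum_{u\sim v}C(u,v)(f(v)-f(u))$. It is symmetric and nonnegative, and $\mathcal{L}_{\Omega,\mu}$ denotes its Friedrichs extension. *)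

theory Defs
  imports "HOL-Analysis.Analysis"
begin

section \<open>Edge-weighted graphs\<close>

text \<open>
  The vertex set is the whole countable type \<open>'v\<close>. An edge is a two-element set of vertices, and
  \<open>R u v\<close> is the length of the edge \<open>{u, v}\<close>; values of \<open>R\<close> off the edge set are never used.
\<close>

locale edge_weighted_graph =
  fixes E :: "'v::countable set set"
    and R :: "'v \<Rightarrow> 'v \<Rightarrow> real"
  assumes simple: "e \<in> E \<Longrightarrow> card e = 2"
    and degree_pos: "\<exists>e\<in>E. v \<in> e"
    and locally_finite: "finite {e \<in> E. v \<in> e}"
    and R_sym: "{u, v} \<in> E \<Longrightarrow> R u v = R v u"
    and R_pos: "{u, v} \<in> E \<Longrightarrow> 0 < R u v"

definition conductance :: "'v set set \<Rightarrow> ('v \<Rightarrow> 'v \<Rightarrow> real) \<Rightarrow> 'v \<Rightarrow> 'v \<Rightarrow> real" where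
  "conductance E R u v = (if {u, v} \<in> E then 1 / R u v else 0)"

definition finite_path :: "'v set set \<Rightarrow> 'v \<Rightarrow> 'v list \<Rightarrow> 'v \<Rightarrow> bool" where
  "finite_path E u p v \<longleftrightarrow>
     p \<noteq> [] \<and> hd p = u \<and> last p = v \<and> (\<forall>i. Suc i < length p \<longrightarrow> {p ! i, p ! Suc i} \<in> E)"

definition graph_connected :: "'v set set \<Rightarrow> bool" where
  "graph_connected E \<longleftrightarrow> (\<forall>u v. \<exists>p. finite_path E u p v)"

definition path_length :: "('v \<Rightarrow> 'v \<Rightarrow> real) \<Rightarrow> 'v list \<Rightarrow> real" where
  "path_length R p = (\<Sum>i<length p - 1. R (p ! i) (p ! Suc i))"

definition graph_dist :: "'v set set \<Rightarrow> ('v \<Rightarrow> 'v \<Rightarrow> real) \<Rightarrow> 'v \<Rightarrow> 'v \<Rightarrow> real" where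
  "graph_dist E R u v = (INF p \<in> {p. finite_path E u p v}. path_length R p)"


section \<open>The metric completion\<close>

text \<open>
  The completion is determined up to isometry. It is realised as the closure of the image of an
  isometric map \<open>\<iota>\<close> from the vertices into some complete metric space; the vertex \<open>v\<close> is identified
  with the point \<open>\<iota> v\<close>. Such a map always exists, for example the Kuratowski embedding into
  \<open>nat \<Rightarrow>\<^sub>C real\<close>, the vertex set being countable.
\<close>

definition isometric_map :: "'v set set \<Rightarrow> ('v \<Rightarrow> 'v \<Rightarrow> real) \<Rightarrow> ('v \<Rightarrow> 'x::complete_space) \<Rightarrow> bool" where
  "isometric_map E R \<iota> \<longleftrightarrow> (\<forall>u v. dist (\<iota> u) (\<iota> v) = graph_dist E R u v)"

definition graph_completion :: "('v \<Rightarrow> 'x::complete_space) \<Rightarrow> 'x set" where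
  "graph_completion \<iota> = closure (range \<iota>)"

text \<open>
  \<open>path_between E \<iota> x F y\<close>: some path in the completion goes from \<open>x\<close> to \<open>y\<close> and has edge set \<open>F\<close>.
  A ray joins its initial vertex to its limit and may be traversed in either direction.
\<close>

inductive path_between :: "'v set set \<Rightarrow> ('v \<Rightarrow> 'x::complete_space) \<Rightarrow> 'x \<Rightarrow> 'v set set \<Rightarrow> 'x \<Rightarrow> bool"
  for E :: "'v set set" and \<iota> :: "'v \<Rightarrow> 'x::complete_space" where
  finite_path: "finite_path E u p v \<Longrightarrow>
    path_between E \<iota> (\<iota> u) {{p ! i, p ! Suc i} | i. Suc i < length p} (\<iota> v)"
| ray: "(\<And>n. {f n, f (Suc n)} \<in> E) \<Longrightarrow> (\<lambda>n. \<iota> (f n)) \<longlonglongrightarrow> y \<Longrightarrow>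
    path_between E \<iota> (\<iota> (f 0)) (range (\<lambda>n. {f n, f (Suc n)})) y"
| reversed_ray: "(\<And>n. {f n, f (Suc n)} \<in> E) \<Longrightarrow> (\<lambda>n. \<iota> (f n)) \<longlonglongrightarrow> x \<Longrightarrow>
    path_between E \<iota> x (range (\<lambda>n. {f n, f (Suc n)})) (\<iota> (f 0))"
| double_ray: "(\<And>k::int. {g k, g (k + 1)} \<in> E) \<Longrightarrow>
    (\<lambda>n. \<iota> (g (- int n))) \<longlonglongrightarrow> x \<Longrightarrow> (\<lambda>n. \<iota> (g (int n))) \<longlonglongrightarrow> y \<Longrightarrow>
    path_between E \<iota> x (range (\<lambda>k. {g k, g (k + 1)})) y"

definition weakly_connected :: "'v set set \<Rightarrow> ('v \<Rightarrow> 'x::complete_space) \<Rightarrow> bool" where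
  "weakly_connected E \<iota> \<longleftrightarrow>
     (\<forall>x\<in>graph_completion \<iota>. \<forall>y\<in>graph_completion \<iota>. x \<noteq> y \<longrightarrow>
        (\<exists>W\<subseteq>E. finite W \<and> (\<forall>F. path_between E \<iota> x F y \<longrightarrow> F \<inter> W \<noteq> {})))"

text \<open>
  The condition \<open>\<Omega> \<noteq> {}\<close> implements the convention that the distance to the empty set is infinite;
  \<open>infdist z {}\<close> is \<open>0\<close>.
\<close>

definition neighborhood :: "('v \<Rightarrow> 'x::complete_space) \<Rightarrow> real \<Rightarrow> 'x set \<Rightarrow> 'x set" where
  "neighborhood \<iota> r \<Omega> = {z \<in> graph_completion \<iota>. \<Omega> \<noteq> {} \<and> infdist z \<Omega> \<le> r}"

definition vertex_measure :: "('v \<Rightarrow> 'x::complete_space) \<Rightarrow> ('v \<Rightarrow> real) \<Rightarrow> 'x set \<Rightarrow> ennreal" where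
  "vertex_measure \<iota> \<mu> U = (\<Sum>\<^sub>\<infinity>v\<in>{v. \<iota> v \<in> U}. ennreal (\<mu> v))"


section \<open>The Hilbert space of square summable functions and Friedrichs extensions\<close>

definition l2 :: "('v \<Rightarrow> real) \<Rightarrow> ('v \<Rightarrow> real) set" where
  "l2 \<mu> = {f. (\<lambda>v. (f v)\<^sup>2 * \<mu> v) summable_on UNIV}"

definition l2_inner :: "('v \<Rightarrow> real) \<Rightarrow> ('v \<Rightarrow> real) \<Rightarrow> ('v \<Rightarrow> real) \<Rightarrow> real" where
  "l2_inner \<mu> f g = (\<Sum>\<^sub>\<infinity>v. f v * g v * \<mu> v)"

definition l2_norm :: "('v \<Rightarrow> real) \<Rightarrow> ('v \<Rightarrow> real) \<Rightarrow> real" where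
  "l2_norm \<mu> f = sqrt (l2_inner \<mu> f f)"

text \<open>An unbounded operator is a partial map; its domain is \<open>dom T\<close>.\<close>

type_synonym 'v operator = "('v \<Rightarrow> real) \<rightharpoonup> ('v \<Rightarrow> real)"

text \<open>
  For a densely defined, symmetric, nonnegative operator \<open>T\<close>, the form \<open>\<langle>T f, g\<rangle>\<close> on \<open>dom T\<close> is
  closable, and the Friedrichs extension of \<open>T\<close> is the self-adjoint operator associated with the
  closure of this form: \<open>f\<close> in the domain of the closed form \<open>t\<close> is mapped to \<open>h\<close> if
  \<open>t(f, g) = \<langle>h, g\<rangle>\<close> for all \<open>g\<close> in the domain of \<open>t\<close>.
\<close>

definition op_form :: "('v \<Rightarrow> real) \<Rightarrow> 'v operator \<Rightarrow> ('v \<Rightarrow> real) \<Rightarrow> ('v \<Rightarrow> real) \<Rightarrow> real" where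
  "op_form \<mu> T f g = l2_inner \<mu> (the (T f)) g"

definition form_approx :: "('v \<Rightarrow> real) \<Rightarrow> 'v operator \<Rightarrow> (nat \<Rightarrow> 'v \<Rightarrow> real) \<Rightarrow> ('v \<Rightarrow> real) \<Rightarrow> bool" where
  "form_approx \<mu> T F f \<longleftrightarrow>
     (\<forall>n. F n \<in> dom T) \<and>
     (\<lambda>n. l2_norm \<mu> (F n - f)) \<longlonglongrightarrow> 0 \<and>
     (\<forall>\<epsilon>>0. \<exists>N. \<forall>m\<ge>N. \<forall>n\<ge>N. op_form \<mu> T (F m - F n) (F m - F n) < \<epsilon>)"

definition closed_form_dom :: "('v \<Rightarrow> real) \<Rightarrow> 'v operator \<Rightarrow> ('v \<Rightarrow> real) set" where
  "closed_form_dom \<mu> T = {f \<in> l2 \<mu>. \<exists>F. form_approx \<mu> T F f}"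

definition closed_form :: "('v \<Rightarrow> real) \<Rightarrow> 'v operator \<Rightarrow> ('v \<Rightarrow> real) \<Rightarrow> ('v \<Rightarrow> real) \<Rightarrow> real" where
  "closed_form \<mu> T f g =
     (THE c. \<forall>F G. form_approx \<mu> T F f \<and> form_approx \<mu> T G g \<longrightarrow>
               (\<lambda>n. op_form \<mu> T (F n) (G n)) \<longlonglongrightarrow> c)"

definition form_represents :: "('v \<Rightarrow> real) \<Rightarrow> 'v operator \<Rightarrow> ('v \<Rightarrow> real) \<Rightarrow> ('v \<Rightarrow> real) \<Rightarrow> bool" where
  "form_represents \<mu> T f h \<longleftrightarrow>
     f \<in> closed_form_dom \<mu> T \<and> h \<in> l2 \<mu> \<and>
     (\<forall>g\<in>closed_form_dom \<mu> T. closed_form \<mu> T f g = l2_inner \<mu> h g)"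

definition friedrichs_extension :: "('v \<Rightarrow> real) \<Rightarrow> 'v operator \<Rightarrow> 'v operator" where
  "friedrichs_extension \<mu> T f =
     (if \<exists>h. form_represents \<mu> T f h then Some (THE h. form_represents \<mu> T f h) else None)"


section \<open>The Laplace operators\<close>

definition finite_jump_algebra :: "'v set set \<Rightarrow> ('v \<Rightarrow> real) set" where
  "finite_jump_algebra E = {\<phi>. finite {e \<in> E. \<exists>u v. e = {u, v} \<and> \<phi> u \<noteq> \<phi> v}}"

text \<open>
  The continuous extension of \<open>\<phi>\<close> to the completion is unique because the vertices are dense.
\<close>

definition algebra_vanishing ::
  "'v set set \<Rightarrow> ('v \<Rightarrow> 'x::complete_space) \<Rightarrow> 'x set \<Rightarrow> ('v \<Rightarrow> real) set" where
  "algebra_vanishing E \<iota> \<Omega> =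
     {\<phi> \<in> finite_jump_algebra E.
        \<exists>\<psi>. continuous_on (graph_completion \<iota>) \<psi> \<and> (\<forall>v. \<psi> (\<iota> v) = \<phi> v) \<and> (\<forall>x\<in>\<Omega>. \<psi> x = 0)}"

definition laplacian ::
  "'v set set \<Rightarrow> ('v \<Rightarrow> 'v \<Rightarrow> real) \<Rightarrow> ('v \<Rightarrow> real) \<Rightarrow> ('v \<Rightarrow> real) \<Rightarrow> 'v \<Rightarrow> real" where
  "laplacian E R \<mu> f v =
     (1 / \<mu> v) * (\<Sum>u\<in>{u. {u, v} \<in> E}. conductance E R u v * (f v - f u))"

definition laplace_op ::
  "'v set set \<Rightarrow> ('v \<Rightarrow> 'v \<Rightarrow> real) \<Rightarrow> ('v \<Rightarrow> 'x::complete_space) \<Rightarrow> ('v \<Rightarrow> real) \<Rightarrow> 'x set \<Rightarrow> 'v operator" where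
  "laplace_op E R \<iota> \<mu> \<Omega> =
     (\<lambda>f. Some (laplacian E R \<mu> f)) |` (algebra_vanishing E \<iota> \<Omega> \<inter> l2 \<mu>)"

definition friedrichs_laplacian ::
  "'v set set \<Rightarrow> ('v \<Rightarrow> 'v \<Rightarrow> real) \<Rightarrow> ('v \<Rightarrow> 'x::complete_space) \<Rightarrow> ('v \<Rightarrow> real) \<Rightarrow> 'x set \<Rightarrow> 'v operator" where
  "friedrichs_laplacian E R \<iota> \<mu> \<Omega> = friedrichs_extension \<mu> (laplace_op E R \<iota> \<mu> \<Omega>)"

end

theory Submission
  imports Defs
begin

text \<open>
  Let \<open>x\<close> lie in \<open>\<Omega>1\<close> but not in \<open>\<Omega>2\<close>. Deleting a finite edge set \<open>W\<close> leaves two vertices in one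
  component if their distance is less than every edge length in \<open>W\<close>; hence, if \<open>W\<close> meets every path
  from \<open>x\<close> to \<open>y\<close>, the component near \<open>x\<close> stays away from \<open>y\<close>. By compactness, finitely many
  such components intersect in a set \<open>A\<close> with finite edge boundary that contains all vertices near
  \<open>x\<close>, avoids \<open>\<Omega>2\<close> and lies in the \<open>r\<close>-neighbourhood of \<open>\<Omega>1\<close>, so that its indicator is in
  \<open>l2 \<mu>\<close>. The indicator then belongs to the domain of the Laplacian for \<open>\<Omega>2\<close>. On the other hand
  \<open>(f v - f u)\<^sup>2 \<le> 2 d(u, v) a(f, f)\<close> for the Dirichlet form \<open>a\<close>, so functions in the closed
  form domain for \<open>\<Omega>1\<close> tend to \<open>0\<close> at \<open>x\<close>, which the indicator does not.
\<close>

section \<open>Paths and separation in the completion\<close>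

lemma finite_path_iff_successively:
  "finite_path E u p v \<longleftrightarrow>
     p \<noteq> [] \<and> hd p = u \<and> last p = v \<and> successively (\<lambda>x y. {x, y} \<in> E) p"
  by (auto simp: finite_path_def successively_conv_nth)

lemma finite_path_append:
  assumes "finite_path E u p v" "finite_path E v q w"
  shows "finite_path E u (p @ tl q) w"
proof -
  obtain q' where q: "q = v # q'"
    using assms(2) by (cases q) (auto simp: finite_path_def)
  show ?thesis
    using assms unfolding finite_path_iff_successively q
    by (cases q') (auto simp: successively_append_iff)
qed

lemma finite_path_rev:
  "finite_path E u p v \<Longrightarrow> finite_path E v (rev p) u"
  by (auto simp: finite_path_iff_successively hd_rev last_rev insert_commute)

lemma finite_path_takeD:
  assumes "finite_path E u (p @ [w] @ q) v"
  shows "finite_path E u (p @ [w]) w"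
  using assms unfolding finite_path_iff_successively
  by (auto simp: successively_append_iff hd_append split: if_splits)

lemma finite_path_dropD:
  assumes "finite_path E u (p @ [w] @ q) v"
  shows "finite_path E w (w # q) v"
  using assms unfolding finite_path_iff_successively
  by (auto simp: successively_append_iff)

lemma path_length_singleton [simp]: "path_length R [u] = 0"
  by (simp add: path_length_def)

lemma path_length_Cons_Cons [simp]:
  "path_length R (u # v # p) = R u v + path_length R (v # p)"
  by (simp add: path_length_def sum.lessThan_Suc_shift del: sum.lessThan_Suc)

lemma path_length_append:
  "path_length R (p @ [w] @ q) = path_length R (p @ [w]) + path_length R (w # q)"
proof (induction p)
  case (Cons a p)
  then show ?case by (cases p) auto
qed simp

text \<open>Compactness and weak connectedness are kept out of the locale: only the separation
  lemmas and the final comparison assume them, while the form theory holds for every connected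
  weighted graph.\<close>

locale completed_graph = edge_weighted_graph E R
  for E :: "'v::countable set set" and R :: "'v \<Rightarrow> 'v \<Rightarrow> real" +
  fixes \<iota> :: "'v \<Rightarrow> 'x::complete_space"
    and \<mu> :: "'v \<Rightarrow> real"
  assumes connected: "graph_connected E"
    and mu_pos: "0 < \<mu> v"
    and isometric: "isometric_map E R \<iota>"
begin

section \<open>Path length and distance in the completion\<close>

lemma path_length_nonneg:
  assumes "finite_path E u p v"
  shows "0 \<le> path_length R p"
  unfolding path_length_def
  by (rule sum_nonneg) (use assms in \<open>auto simp: finite_path_def intro!: less_imp_le R_pos\<close>)

lemma edge_le_path_length:
  assumes "finite_path E u p v" "Suc i < length p"
  shows "R (p ! i) (p ! Suc i) \<le> path_length R p"
  unfolding path_length_def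
  by (rule member_le_sum) (use assms in \<open>auto simp: finite_path_def intro!: less_imp_le R_pos\<close>)

lemma dist_le_path_length:
  assumes "finite_path E u p v"
  shows "dist (\<iota> u) (\<iota> v) \<le> path_length R p"
proof -
  have "bdd_below (path_length R ` {p. finite_path E u p v})"
    by (rule bdd_belowI[of _ 0]) (auto intro: path_length_nonneg)
  with assms show ?thesis
    using isometric unfolding isometric_map_def graph_dist_def
    by (auto intro!: cINF_lower)
qed

text \<open>Cutting the path at \<open>w\<close> leaves a remainder of nonnegative length. This
  keeps every vertex of a short path close to its start.\<close>

lemma dist_le_path_length_mem:
  assumes "finite_path E u p v" "w \<in> set p"
  shows "dist (\<iota> u) (\<iota> w) \<le> path_length R p"
proof -
  obtain p1 p2 where p: "p = p1 @ [w] @ p2"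
    using split_list[OF assms(2)] by auto
  have "finite_path E w (w # p2) v"
    using assms(1) unfolding p by (rule finite_path_dropD)
  then have "path_length R (p1 @ [w]) \<le> path_length R p"
    unfolding p path_length_append using path_length_nonneg by fastforce
  with dist_le_path_length[OF finite_path_takeD] assms(1) p show ?thesis
    by (metis order_trans)
qed

text \<open>Connectedness makes the set of paths nonempty, so the infimum in
  \<open>graph_dist\<close> is a greatest lower bound.\<close>

lemma le_dist_if_le_path_length:
  assumes "\<And>p. finite_path E u p v \<Longrightarrow> c \<le> path_length R p"
  shows "c \<le> dist (\<iota> u) (\<iota> v)"
proof -
  have "{p. finite_path E u p v} \<noteq> {}"
    using connected by (auto simp: graph_connected_def)
  then show ?thesis
    using isometric assms unfolding isometric_map_def graph_dist_def
    by (auto intro!: cINF_greatest)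
qed

lemma short_path_exists:
  assumes "dist (\<iota> u) (\<iota> v) < c"
  obtains p where "finite_path E u p v" "path_length R p < c"
  using le_dist_if_le_path_length[of u v c] assms by (meson not_le)

lemma edge_length_bound:
  assumes "finite W" "W \<subseteq> E"
  obtains \<delta> where "\<delta> > 0" "\<And>u v. {u, v} \<in> W \<Longrightarrow> \<delta> \<le> R u v"
proof -
  define P where "P = {(u, v). {u, v} \<in> W}"
  have "finite e" if "e \<in> W" for e
    using simple[of e] that assms(2) by (intro card_ge_0_finite) auto
  then have "finite (\<Union>W)" using assms(1) by auto
  moreover have "P \<subseteq> \<Union>W \<times> \<Union>W" unfolding P_def by auto
  ultimately have fin: "finite P" by (meson finite_SigmaI finite_subset)
  \<comment> \<open>The entry 1 keeps the minimum defined and positive when \<open>W\<close> is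
    empty.\<close>
  define \<delta> where "\<delta> = Min (insert 1 ((\<lambda>(u, v). R u v) ` P))"
  show ?thesis
  proof
    show "\<delta> > 0"
      unfolding \<delta>_def using fin assms(2) by (auto simp: P_def intro!: R_pos)
    show "\<delta> \<le> R u v" if "{u, v} \<in> W" for u v
      unfolding \<delta>_def using fin that by (intro Min_le) (auto simp: P_def)
  qed
qed

text \<open>A path is at least as long as each of its edges, so a path shorter than all edges of
  \<open>W\<close> uses none of them.\<close>

lemma short_paths_avoid:
  assumes "finite W" "W \<subseteq> E"
  obtains \<delta> where "\<delta> > 0"
    "\<And>u p v. finite_path E u p v \<Longrightarrow> path_length R p < \<delta> \<Longrightarrow> finite_path (E - W) u p v"
proof -
  obtain \<delta> where \<delta>: "\<delta> > 0" "\<And>u v. {u, v} \<in> W \<Longrightarrow> \<delta> \<le> R u v"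
    using edge_length_bound[OF assms] by blast
  show ?thesis
  proof (rule that[OF \<delta>(1)])
    fix u p v assume p: "finite_path E u p v" "path_length R p < \<delta>"
    have "{p ! i, p ! Suc i} \<notin> W" if "Suc i < length p" for i
      using edge_le_path_length[OF p(1) that] p(2) \<delta>(2)[of "p ! i" "p ! Suc i"] by fastforce
    with p(1) show "finite_path (E - W) u p v" by (auto simp: finite_path_def)
  qed
qed

section \<open>Components after the deletion of finitely many edges\<close>

text \<open>This is the relation of lying in the same component once the edges of \<open>W\<close>
  are deleted.\<close>

definition linked :: "'v set set \<Rightarrow> 'v \<Rightarrow> 'v \<Rightarrow> bool" where
  "linked W u v \<longleftrightarrow> (\<exists>p. finite_path (E - W) u p v)"

lemma linked_trans: "linked W u v \<Longrightarrow> linked W v w \<Longrightarrow> linked W u w"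
  unfolding linked_def by (blast intro: finite_path_append)

lemma linked_sym: "linked W u v \<Longrightarrow> linked W v u"
  unfolding linked_def by (blast intro: finite_path_rev)

lemma linked_refl: "linked W u u"
  unfolding linked_def by (rule exI[of _ "[u]"]) (simp add: finite_path_def)

lemma linked_edge: "{u, v} \<in> E - W \<Longrightarrow> linked W u v"
  unfolding linked_def
  by (rule exI[of _ "[u, v]"]) (auto simp: finite_path_def less_Suc_eq)

text \<open>
  The ray is the limit of finite paths \<open>L k\<close>, each extending the previous one. The end of \<open>L k\<close>
  is not \<open>x\<close>, so there is a vertex closer to \<open>x\<close>, and the two can be joined by a path too short
  to use an edge of \<open>W\<close>.
\<close>

lemma ray_to_boundary_point:
  assumes W: "finite W" "W \<subseteq> E" and x: "x \<in> graph_completion \<iota> - range \<iota>"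
  obtains \<delta> where "\<delta> > 0"
    "\<And>a v. dist (\<iota> v) x < \<delta> \<Longrightarrow> linked W a v \<Longrightarrow>
       \<exists>f. f 0 = a \<and> (\<forall>n. {f n, f (Suc n)} \<in> E - W) \<and> (\<lambda>n. \<iota> (f n)) \<longlonglongrightarrow> x"
proof -
  obtain \<delta>' where \<delta>': "\<delta>' > 0"
    "\<And>u p v. finite_path E u p v \<Longrightarrow> path_length R p < \<delta>' \<Longrightarrow> finite_path (E - W) u p v"
    using short_paths_avoid[OF W] by blast
  \<comment> \<open>Two vertices within \<open>e k\<close> of \<open>x\<close> are less than
    \<open>2 * e k\<close> apart, and this is at most \<open>\<delta>'\<close>.\<close>
  define \<delta> where "\<delta> = \<delta>' / 2"
  define e where "e k = \<delta> / real (Suc k)" for k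
  have \<delta>: "\<delta> > 0" using \<delta>' by (simp add: \<delta>_def)
  have e_pos: "e k > 0" for k using \<delta> by (simp add: e_def)
  have e_antimono: "e k \<le> e j" if "j \<le> k" for j k
    unfolding e_def using \<delta> that by (intro divide_left_mono) auto
  have e_le: "e k \<le> \<delta>" for k using e_antimono[of 0 k] by (simp add: e_def)
  show ?thesis
  proof (rule that[OF \<delta>])
    fix a v assume v: "dist (\<iota> v) x < \<delta>" "linked W a v"
    define P where "P k p \<longleftrightarrow> finite_path (E - W) a p (last p) \<and> dist (\<iota> (last p)) x < e k" for k p
    \<comment> \<open>The bound \<open>3 * e k\<close> is the sum of \<open>e k\<close>, for the
      distance from the old end to \<open>x\<close>, and \<open>2 * e k\<close>, for the length of
      the connecting path.\<close>
    define Q where "Q k p p' \<longleftrightarrow> (\<exists>q. q \<noteq> [] \<and> p' = p @ q \<and> (\<forall>w\<in>set q. dist (\<iota> w) x < 3 * e k))"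
      for k and p p' :: "'v list"
    have "\<exists>p. P 0 p"
      using v by (auto simp: P_def linked_def e_def finite_path_def)
    moreover have "\<exists>p'. P (Suc k) p' \<and> Q k p p'" if p: "P k p" for k p
    proof -
      let ?u = "last p"
      have "\<iota> ?u \<noteq> x" using x by auto
      then have "0 < min (e (Suc k)) (dist (\<iota> ?u) x)" using e_pos by auto
      then obtain w where "dist (\<iota> w) x < min (e (Suc k)) (dist (\<iota> ?u) x)"
        using x unfolding graph_completion_def Diff_iff closure_approachable by (metis imageE)
      then have w: "dist (\<iota> w) x < e (Suc k)" "dist (\<iota> w) x < dist (\<iota> ?u) x" by auto
      have "dist (\<iota> ?u) (\<iota> w) < 2 * e k"
        using dist_triangle2[of "\<iota> ?u" "\<iota> w" x] p w(2) unfolding P_def by linarith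
      then obtain q where q: "finite_path E ?u q w" "path_length R q < 2 * e k"
        using short_path_exists by blast
      then have "finite_path (E - W) ?u q w"
        using \<delta>'(2) e_le[of k] unfolding \<delta>_def by force
      then have path: "finite_path (E - W) a (p @ tl q) w"
        using p finite_path_append[of "E - W" a p ?u q w] unfolding P_def by simp
      have "P (Suc k) (p @ tl q)"
        using path w(1) unfolding P_def finite_path_def by auto
      moreover have "Q k p (p @ tl q)"
        unfolding Q_def
      proof (intro exI conjI ballI)
        \<comment> \<open>The new end is strictly closer to \<open>x\<close> than the old one, so
          the two differ and the path really grows.\<close>
        show "tl q \<noteq> []"
          using q(1) w(2) by (cases q) (auto simp: finite_path_def split: if_splits)
        fix z assume "z \<in> set (tl q)"
        then have "z \<in> set q" by (cases q) auto
        then have "dist (\<iota> ?u) (\<iota> z) < 2 * e k"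
          using dist_le_path_length_mem[OF q(1)] q(2) by fastforce
        then show "dist (\<iota> z) x < 3 * e k"
          using dist_triangle3[of "\<iota> z" x "\<iota> ?u"] p unfolding P_def by linarith
      qed simp
      ultimately show ?thesis by blast
    qed
    ultimately obtain L where L: "\<And>k. P k (L k)" "\<And>k. Q k (L k) (L (Suc k))"
      using dependent_nat_choice[of P Q] by blast
    \<comment> \<open>Every extension adds a vertex, so the diagonal entry \<open>L n ! n\<close>
      exists and defines the ray.\<close>
    have len: "k < length (L k)" for k
    proof (induction k)
      case 0
      show ?case using L(1)[of 0] by (auto simp: P_def finite_path_def)
    next
      case (Suc k)
      obtain q where "q \<noteq> []" "L (Suc k) = L k @ q" using L(2)[of k] by (auto simp: Q_def)
      with Suc show ?case by (cases q) auto
    qed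
    have prefix: "length (L j) \<le> length (L k) \<and> (\<forall>i<length (L j). L k ! i = L j ! i)" if "j \<le> k" for j k
      using that
    proof (induction k rule: dec_induct)
      case (step k)
      then show ?case using L(2)[of k] by (auto simp: Q_def nth_append)
    qed simp
    \<comment> \<open>Entries beyond \<open>L j\<close> were added at step \<open>j\<close> or
      later, where the radii are no larger.\<close>
    have near: "\<forall>i. length (L j) \<le> i \<and> i < length (L k) \<longrightarrow> dist (\<iota> (L k ! i)) x < 3 * e j"
      if "j \<le> k" for j k
      using that
    proof (induction k rule: dec_induct)
      case (step k)
      obtain q where q: "L (Suc k) = L k @ q" "\<forall>w\<in>set q. dist (\<iota> w) x < 3 * e k"
        using L(2)[of k] by (auto simp: Q_def)
      have "dist (\<iota> w) x < 3 * e j" if "w \<in> set q" for w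
        using q(2) that e_antimono[OF step(1)] by force
      with step q(1) show ?case by (auto simp: nth_append)
    qed simp
    define f where "f n = L n ! n" for n
    have f: "f n = L k ! n" if "n \<le> k" for n k
      using prefix[OF that] len[of n] by (auto simp: f_def)
    have "f 0 = a"
      using L(1)[of 0] by (auto simp: f_def P_def finite_path_def hd_conv_nth)
    moreover have "{f n, f (Suc n)} \<in> E - W" for n
      using L(1)[of "Suc n"] len[of "Suc n"] f[of n "Suc n"] f[of "Suc n" "Suc n"]
      by (auto simp: P_def finite_path_def)
    moreover have "(\<lambda>n. \<iota> (f n)) \<longlonglongrightarrow> x"
    proof (rule metric_LIMSEQ_I)
      fix r :: real assume "0 < r"
      obtain k :: nat where "3 * \<delta> / r < real k"
        using reals_Archimedean2 by blast
      then have "3 * \<delta> < r * real (Suc k)"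
        using \<open>0 < r\<close> by (simp add: pos_divide_less_eq algebra_simps)
      then have k: "3 * e k < r"
        unfolding e_def by (simp add: pos_divide_less_eq del: of_nat_Suc)
      show "\<exists>N. \<forall>n\<ge>N. dist (\<iota> (f n)) x < r"
      proof (intro exI allI impI)
        fix n assume n: "length (L k) \<le> n"
        then have "k \<le> n" using len[of k] by simp
        then show "dist (\<iota> (f n)) x < r"
          using near[of k n] n len[of n] k unfolding f_def by (meson less_trans)
      qed
    qed
    ultimately show "\<exists>f. f 0 = a \<and> (\<forall>n. {f n, f (Suc n)} \<in> E - W) \<and> (\<lambda>n. \<iota> (f n)) \<longlonglongrightarrow> x"
      by blast
  qed
qed

section \<open>Separating a boundary point from points and from compact sets\<close>

text \<open>Finiteness of this set is what puts the indicator of \<open>A\<close> into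
  \<open>finite_jump_algebra\<close>.\<close>

definition edge_boundary :: "'v set \<Rightarrow> 'v set set" where
  "edge_boundary A = {e \<in> E. \<exists>u v. e = {u, v} \<and> u \<in> A \<and> v \<notin> A}"

text \<open>Take for \<open>A\<close> the union of the components of \<open>E - W\<close> that come
  close to \<open>x\<close>. A vertex of \<open>A\<close> near \<open>y\<close> would yield a ray to
  \<open>x\<close> and, unless \<open>y\<close> is itself a vertex, another to \<open>y\<close>,
  both avoiding \<open>W\<close>. Together they would form a path from \<open>x\<close> to
  \<open>y\<close> that misses \<open>W\<close>.\<close>

lemma separate_points:
  assumes wc: "weakly_connected E \<iota>" and x: "x \<in> graph_completion \<iota> - range \<iota>"
    and y: "y \<in> graph_completion \<iota>" "y \<noteq> x"
  obtains A \<delta> where "\<delta> > 0" "finite (edge_boundary A)"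
    "\<And>v. dist (\<iota> v) x < \<delta> \<Longrightarrow> v \<in> A"
    "\<And>v. dist (\<iota> v) y < \<delta> \<Longrightarrow> v \<notin> A"
proof -
  obtain W where W: "W \<subseteq> E" "finite W" "\<And>F. path_between E \<iota> x F y \<Longrightarrow> F \<inter> W \<noteq> {}"
    using wc x y unfolding weakly_connected_def by (metis DiffD1)
  obtain \<delta>1 where \<delta>1: "\<delta>1 > 0" and ray_x:
    "\<And>a v. dist (\<iota> v) x < \<delta>1 \<Longrightarrow> linked W a v \<Longrightarrow>
       \<exists>f. f 0 = a \<and> (\<forall>n. {f n, f (Suc n)} \<in> E - W) \<and> (\<lambda>n. \<iota> (f n)) \<longlonglongrightarrow> x"
    using ray_to_boundary_point[OF W(2,1) x] by blast
  define A where "A = {a. \<exists>v. dist (\<iota> v) x < \<delta>1 \<and> linked W a v}"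
  \<comment> \<open>An edge outside \<open>W\<close> joins vertices of one component, so it cannot
    leave \<open>A\<close>.\<close>
  have "{u, v} \<in> W" if "{u, v} \<in> E" "u \<in> A" "v \<notin> A" for u v
  proof (rule ccontr)
    assume "{u, v} \<notin> W"
    with that have "linked W v u" by (intro linked_sym[OF linked_edge]) auto
    with that show False using linked_trans unfolding A_def by blast
  qed
  then have "edge_boundary A \<subseteq> W" by (auto simp: edge_boundary_def)
  then have fin: "finite (edge_boundary A)" using W(2) finite_subset by blast
  have near_x: "v \<in> A" if "dist (\<iota> v) x < \<delta>1" for v
    using that linked_refl by (auto simp: A_def)
  have "\<exists>\<delta>2>0. \<forall>v. dist (\<iota> v) y < \<delta>2 \<longrightarrow> v \<notin> A"
  proof (cases "y \<in> range \<iota>")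
    case True
    then obtain b where b: "y = \<iota> b" by auto
    obtain \<delta> where \<delta>: "\<delta> > 0"
      "\<And>u p v. finite_path E u p v \<Longrightarrow> path_length R p < \<delta> \<Longrightarrow> finite_path (E - W) u p v"
      using short_paths_avoid[OF W(2,1)] by blast
    have "v \<notin> A" if "dist (\<iota> v) y < \<delta>" for v
    proof
      assume "v \<in> A"
      have "linked W b v"
        using that short_path_exists[of b v \<delta>] \<delta>(2) unfolding b linked_def
        by (metis dist_commute)
      with \<open>v \<in> A\<close> obtain f where f: "f 0 = b" "\<And>n. {f n, f (Suc n)} \<in> E - W" "(\<lambda>n. \<iota> (f n)) \<longlonglongrightarrow> x"
        using ray_x linked_trans unfolding A_def by blast
      \<comment> \<open>Read backwards from its limit, the ray goes from \<open>x\<close> to the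
        vertex \<open>b\<close>.\<close>
      then have "path_between E \<iota> x (range (\<lambda>n. {f n, f (Suc n)})) y"
        unfolding b f(1)[symmetric] by (intro reversed_ray) auto
      with W(3) f(2) show False by blast
    qed
    with \<delta>(1) show ?thesis by blast
  next
    case False
    then obtain \<delta>2 where \<delta>2: "\<delta>2 > 0" and ray_y:
      "\<And>a v. dist (\<iota> v) y < \<delta>2 \<Longrightarrow> linked W a v \<Longrightarrow>
         \<exists>f. f 0 = a \<and> (\<forall>n. {f n, f (Suc n)} \<in> E - W) \<and> (\<lambda>n. \<iota> (f n)) \<longlonglongrightarrow> y"
      using ray_to_boundary_point[OF W(2,1)] y(1) by blast
    have "v \<notin> A" if v: "dist (\<iota> v) y < \<delta>2" for v
    proof
      assume "v \<in> A"
      then obtain f where f: "f 0 = v" "\<And>n. {f n, f (Suc n)} \<in> E - W" "(\<lambda>n. \<iota> (f n)) \<longlonglongrightarrow> x"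
        using ray_x unfolding A_def by blast
      obtain h where h: "h 0 = v" "\<And>n. {h n, h (Suc n)} \<in> E - W" "(\<lambda>n. \<iota> (h n)) \<longlonglongrightarrow> y"
        using ray_y[OF v linked_refl] by blast
      \<comment> \<open>The two rays share the start \<open>v\<close> and are glued there:
        nonnegative indices follow \<open>h\<close> to \<open>y\<close>, negative ones follow
        \<open>f\<close> to \<open>x\<close>.\<close>
      define g where "g k = (if 0 \<le> k then h (nat k) else f (nat (- k)))" for k :: int
      have edges: "{g k, g (k + 1)} \<in> E - W" for k
      proof (cases "0 \<le> k")
        case True
        then show ?thesis using h(2)[of "nat k"] by (simp add: g_def nat_add_distrib)
      next
        case False
        \<comment> \<open>For \<open>k = -1\<close> the successor index 0 falls into the branch of
          \<open>h\<close>; the common start makes both branches agree there.\<close>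
        have "g (k + 1) = f (nat (- (k + 1)))"
          using False f(1) h(1) by (cases "k = -1") (auto simp: g_def)
        moreover have "nat (- k) = Suc (nat (- (k + 1)))" using False by auto
        ultimately show ?thesis
          using f(2)[of "nat (- (k + 1))"] False by (simp add: g_def insert_commute)
      qed
      have "g (- int n) = f n" "g (int n) = h n" for n
        using f(1) h(1) by (auto simp: g_def)
      then have "path_between E \<iota> x (range (\<lambda>k. {g k, g (k + 1)})) y"
        using edges f(3) h(3) by (intro double_ray) auto
      with W(3) edges show False by blast
    qed
    with \<delta>2 show ?thesis by blast
  qed
  then obtain \<delta>2 where \<delta>2: "\<delta>2 > 0" "\<And>v. dist (\<iota> v) y < \<delta>2 \<Longrightarrow> v \<notin> A" by blast
  show ?thesis
    by (rule that[of "min \<delta>1 \<delta>2" A]) (use \<delta>1 \<delta>2 fin near_x in auto)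
qed

text \<open>Finitely many of the balls around points of \<open>K\<close> supplied by
  \<open>separate_points\<close> cover \<open>K\<close>. An edge leaving the intersection of the
  corresponding sets leaves one of them, so the boundary stays finite.\<close>

lemma separate_compact:
  assumes wc: "weakly_connected E \<iota>" and x: "x \<in> graph_completion \<iota> - range \<iota>"
    and K: "compact K" "K \<subseteq> graph_completion \<iota>" "x \<notin> K"
  obtains A \<delta> where "\<delta> > 0" "finite (edge_boundary A)"
    "\<And>v. dist (\<iota> v) x < \<delta> \<Longrightarrow> v \<in> A"
    "\<And>y. y \<in> K \<Longrightarrow> \<exists>e>0. \<forall>v. dist (\<iota> v) y < e \<longrightarrow> v \<notin> A"
proof -
  have "\<forall>y\<in>K. \<exists>A \<delta>. \<delta> > 0 \<and> finite (edge_boundary A) \<and> (\<forall>v. dist (\<iota> v) x < \<delta> \<longrightarrow> v \<in> A)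
      \<and> (\<forall>v. dist (\<iota> v) y < \<delta> \<longrightarrow> v \<notin> A)"
    using separate_points[OF wc x] K by (metis subsetD)
  then obtain A \<delta> where A: "\<And>y. y \<in> K \<Longrightarrow> \<delta> y > 0" "\<And>y. y \<in> K \<Longrightarrow> finite (edge_boundary (A y))"
    "\<And>y v. y \<in> K \<Longrightarrow> dist (\<iota> v) x < \<delta> y \<Longrightarrow> v \<in> A y"
    "\<And>y v. y \<in> K \<Longrightarrow> dist (\<iota> v) y < \<delta> y \<Longrightarrow> v \<notin> A y"
    by metis
  have "K \<subseteq> (\<Union>y\<in>K. ball y (\<delta> y))" using A(1) by auto
  then obtain D where D: "D \<subseteq> K" "finite D" "K \<subseteq> (\<Union>y\<in>D. ball y (\<delta> y))"
    using compactE_image[OF K(1), of K "\<lambda>y. ball y (\<delta> y)"] by auto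
  define B where "B = (\<Inter>y\<in>D. A y)"
  have "edge_boundary B \<subseteq> (\<Union>y\<in>D. edge_boundary (A y))"
    unfolding edge_boundary_def B_def by fast
  then have fin: "finite (edge_boundary B)"
    by (rule finite_subset) (use D A(2) in auto)
  show ?thesis
  proof (rule that[of "Min (insert 1 (\<delta> ` D))" B])
    \<comment> \<open>The entry 1 covers the case of an empty \<open>K\<close>, where
      \<open>D\<close> is empty too.\<close>
    show "0 < Min (insert 1 (\<delta> ` D))" using D A(1) by auto
    show "finite (edge_boundary B)" by fact
    show "v \<in> B" if "dist (\<iota> v) x < Min (insert 1 (\<delta> ` D))" for v
      using that D A(3) unfolding B_def by auto
    fix y assume "y \<in> K"
    then obtain z where z: "z \<in> D" "y \<in> ball z (\<delta> z)" using D(3) by auto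
    show "\<exists>e>0. \<forall>v. dist (\<iota> v) y < e \<longrightarrow> v \<notin> B"
    proof (intro exI[of _ "\<delta> z - dist z y"] conjI allI impI)
      show "0 < \<delta> z - dist z y" using z(2) by auto
      fix v assume "dist (\<iota> v) y < \<delta> z - dist z y"
      then have "dist (\<iota> v) z < \<delta> z" using dist_triangle2[of "\<iota> v" z y] by linarith
      then show "v \<notin> B" using A(4) D(1) z(1) unfolding B_def by auto
    qed
  qed
qed


section \<open>The Dirichlet form\<close>

text \<open>This set contains the support of the Laplacian of \<open>f\<close>. It is finite for
  \<open>f\<close> in the algebra, so pairings with the Laplacian become finite sums.\<close>

definition jump_vertices :: "('v \<Rightarrow> real) \<Rightarrow> 'v set" where
  "jump_vertices f = {v. \<exists>u. {u, v} \<in> E \<and> f u \<noteq> f v}"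

text \<open>Pairing with the Laplacian makes the form agree with \<open>op_form\<close> by
  unfolding. It does not depend on the boundary set, so one form serves all the operators.\<close>

definition dirichlet_form :: "('v \<Rightarrow> real) \<Rightarrow> ('v \<Rightarrow> real) \<Rightarrow> real" where
  "dirichlet_form f g = l2_inner \<mu> (laplacian E R \<mu> f) g"

lemma conductance_nonneg: "0 \<le> conductance E R u v"
  using R_pos[of u v] by (auto simp: conductance_def less_imp_le)

lemma conductance_commute: "conductance E R u v = conductance E R v u"
  using R_sym[of u v] by (auto simp: conductance_def insert_commute)

lemma finite_jump_vertices:
  assumes "f \<in> finite_jump_algebra E"
  shows "finite (jump_vertices f)"
proof -
  have "jump_vertices f \<subseteq> \<Union>{e \<in> E. \<exists>u v. e = {u, v} \<and> f u \<noteq> f v}"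
    unfolding jump_vertices_def by blast
  moreover have "finite e" if "e \<in> E" for e
    using simple[OF that] by (intro card_ge_0_finite) auto
  ultimately show ?thesis
    using assms by (auto simp: finite_jump_algebra_def intro: finite_subset)
qed

lemma finite_neighbors: "finite {u. {u, v} \<in> E}"
proof (rule finite_imageD)
  show "finite ((\<lambda>u. {u, v}) ` {u. {u, v} \<in> E})"
    by (rule finite_subset[OF _ locally_finite[of v]]) auto
  show "inj_on (\<lambda>u. {u, v}) {u. {u, v} \<in> E}"
    by (auto simp: inj_on_def doubleton_eq_iff)
qed

lemma laplacian_outside:
  "v \<notin> jump_vertices f \<Longrightarrow> laplacian E R \<mu> f v = 0"
  by (auto simp: laplacian_def jump_vertices_def intro!: sum.neutral)

text \<open>Summation by parts: exchanging the two ends of each edge gives a second expression for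
  the form, and the average of the two is symmetric. The set \<open>S\<close> may be any finite
  superset, so that several functions can share it.\<close>

lemma dirichlet_form_eq:
  assumes S: "finite S" "jump_vertices f \<subseteq> S"
  shows "dirichlet_form f g =
    (\<Sum>v\<in>S. \<Sum>u\<in>S. conductance E R u v * (f v - f u) * (g v - g u)) / 2"
proof -
  let ?c = "conductance E R"
  have lap: "laplacian E R \<mu> f v * \<mu> v = (\<Sum>u\<in>S. ?c u v * (f v - f u))" if "v \<in> S" for v
  proof -
    have "(\<Sum>u\<in>{u. {u, v} \<in> E}. ?c u v * (f v - f u)) = (\<Sum>u\<in>{u. {u, v} \<in> E} \<union> S. ?c u v * (f v - f u))"
      by (rule sum.mono_neutral_left) (use S finite_neighbors in \<open>auto simp: conductance_def\<close>)
    also have "\<dots> = (\<Sum>u\<in>S. ?c u v * (f v - f u))"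
    proof (rule sum.mono_neutral_right)
      \<comment> \<open>A neighbour outside \<open>S\<close> is no jump vertex, so \<open>f\<close>
        is constant along the edge.\<close>
      have "f v = f u" if "{u, v} \<in> E" "u \<notin> S" for u
        using S(2) that by (auto simp: jump_vertices_def insert_commute)
      then show "\<forall>i\<in>{u. {u, v} \<in> E} \<union> S - S. ?c i v * (f v - f i) = 0" by auto
    qed (use S finite_neighbors in auto)
    finally show ?thesis
      using mu_pos[of v] by (simp add: laplacian_def)
  qed
  have "dirichlet_form f g = (\<Sum>v\<in>S. laplacian E R \<mu> f v * g v * \<mu> v)"
    unfolding dirichlet_form_def l2_inner_def
    by (subst infsum_finite[OF S(1), symmetric], rule infsum_cong_neutral)
      (use S(2) laplacian_outside in auto)
  also have "\<dots> = (\<Sum>v\<in>S. \<Sum>u\<in>S. ?c u v * (f v - f u) * g v)"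
    by (intro sum.cong refl) (simp add: lap[symmetric] sum_distrib_right[symmetric])
  finally have 1: "dirichlet_form f g = (\<Sum>v\<in>S. \<Sum>u\<in>S. ?c u v * (f v - f u) * g v)" .
  have "(\<Sum>v\<in>S. \<Sum>u\<in>S. ?c u v * (f v - f u) * g v) = (\<Sum>u\<in>S. \<Sum>v\<in>S. ?c u v * (f v - f u) * g v)"
    by (rule sum.swap)
  also have "\<dots> = (\<Sum>v\<in>S. \<Sum>u\<in>S. - (?c u v * (f v - f u) * g u))"
    by (intro sum.cong refl) (simp add: conductance_commute[of _ v for v] algebra_simps)
  finally have 2: "dirichlet_form f g = (\<Sum>v\<in>S. \<Sum>u\<in>S. - (?c u v * (f v - f u) * g u))"
    using 1 by simp
  have "2 * dirichlet_form f g = (\<Sum>v\<in>S. \<Sum>u\<in>S. ?c u v * (f v - f u) * (g v - g u))"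
    using arg_cong2[OF 1 2, of "(+)"] by (simp add: sum.distrib[symmetric] algebra_simps)
  then show ?thesis by simp
qed

text \<open>A single sum over ordered pairs suits the Cauchy-Schwarz inequality and the selection of
  the edges of a path.\<close>

lemma dirichlet_form_eq_prod:
  assumes "finite S" "jump_vertices f \<subseteq> S"
  shows "dirichlet_form f g =
    (\<Sum>(u, v)\<in>S \<times> S. conductance E R u v * (f v - f u) * (g v - g u)) / 2"
proof -
  have "(\<Sum>v\<in>S. \<Sum>u\<in>S. conductance E R u v * (f v - f u) * (g v - g u)) =
      (\<Sum>u\<in>S. \<Sum>v\<in>S. conductance E R u v * (f v - f u) * (g v - g u))"
    by (rule sum.swap)
  then show ?thesis
    unfolding dirichlet_form_eq[OF assms] by (simp add: sum.cartesian_product)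
qed

lemma jump_vertices_diff:
  "jump_vertices (f - g) \<subseteq> jump_vertices f \<union> jump_vertices g"
  by (fastforce simp: jump_vertices_def)

lemma finite_jump_algebra_diff:
  assumes "f \<in> finite_jump_algebra E" "g \<in> finite_jump_algebra E"
  shows "f - g \<in> finite_jump_algebra E"
proof -
  have "{e \<in> E. \<exists>u v. e = {u, v} \<and> (f - g) u \<noteq> (f - g) v} \<subseteq>
      {e \<in> E. \<exists>u v. e = {u, v} \<and> f u \<noteq> f v} \<union> {e \<in> E. \<exists>u v. e = {u, v} \<and> g u \<noteq> g v}"
    by force
  with assms show ?thesis
    unfolding finite_jump_algebra_def mem_Collect_eq by (meson finite_UnI finite_subset)
qed

lemma common_jump_vertices:
  assumes "f \<in> finite_jump_algebra E" "g \<in> finite_jump_algebra E"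
  obtains S where "finite S" "jump_vertices f \<subseteq> S" "jump_vertices g \<subseteq> S" "jump_vertices (f - g) \<subseteq> S"
  by (rule that[of "jump_vertices f \<union> jump_vertices g"])
    (use assms finite_jump_vertices jump_vertices_diff in auto)

lemma dirichlet_form_commute:
  assumes "f \<in> finite_jump_algebra E" "g \<in> finite_jump_algebra E"
  shows "dirichlet_form f g = dirichlet_form g f"
  by (rule common_jump_vertices[OF assms]) (simp add: dirichlet_form_eq_prod mult_ac)

lemma dirichlet_form_diff_left:
  assumes "f \<in> finite_jump_algebra E" "g \<in> finite_jump_algebra E"
  shows "dirichlet_form (f - g) h = dirichlet_form f h - dirichlet_form g h"
proof (rule common_jump_vertices[OF assms])
  fix S assume S: "finite S" "jump_vertices f \<subseteq> S" "jump_vertices g \<subseteq> S" "jump_vertices (f - g) \<subseteq> S"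
  show ?thesis
    unfolding S(2-4)[THEN dirichlet_form_eq_prod[OF S(1)]] diff_divide_distrib[symmetric]
      sum_subtractf[symmetric]
    by (intro arg_cong2[of _ _ _ _ "(/)"] sum.cong refl) (auto simp: algebra_simps)
qed

lemma dirichlet_form_diff_right:
  assumes "f \<in> finite_jump_algebra E"
  shows "dirichlet_form f (g - h) = dirichlet_form f g - dirichlet_form f h"
  unfolding dirichlet_form_eq_prod[OF finite_jump_vertices[OF assms] order_refl]
    diff_divide_distrib[symmetric] sum_subtractf[symmetric]
  by (intro arg_cong2[of _ _ _ _ "(/)"] sum.cong refl) (auto simp: algebra_simps)

lemma dirichlet_form_nonneg:
  assumes "f \<in> finite_jump_algebra E"
  shows "0 \<le> dirichlet_form f f"
  using finite_jump_vertices[OF assms]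
  by (auto simp: dirichlet_form_eq_prod[OF _ order_refl] mult.assoc conductance_nonneg intro!: sum_nonneg)

text \<open>The form is half the Euclidean inner product of the differences weighted by square roots
  of conductances.\<close>

lemma dirichlet_form_Cauchy_Schwarz:
  assumes "f \<in> finite_jump_algebra E" "g \<in> finite_jump_algebra E"
  shows "(dirichlet_form f g)\<^sup>2 \<le> dirichlet_form f f * dirichlet_form g g"
proof (rule common_jump_vertices[OF assms])
  fix S assume S: "finite S" "jump_vertices f \<subseteq> S" "jump_vertices g \<subseteq> S"
  let ?w = "\<lambda>f (u, v). sqrt (conductance E R u v) * (f v - f u) :: real"
  have w: "?w h p * ?w k p = (\<lambda>(u, v). conductance E R u v * (h v - h u) * (k v - k u)) p" for h k p
  proof (cases p)
    case (Pair u v)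
    have "?w h p * ?w k p = (sqrt (conductance E R u v) * sqrt (conductance E R u v)) * (h v - h u) * (k v - k u)"
      unfolding Pair prod.case by (simp only: mult_ac)
    then show ?thesis by (simp add: Pair conductance_nonneg)
  qed
  have eq: "dirichlet_form h k = (\<Sum>p\<in>S \<times> S. ?w h p * ?w k p) / 2" if "jump_vertices h \<subseteq> S" for h k
    unfolding w by (rule dirichlet_form_eq_prod[OF S(1) that])
  have "(\<Sum>p\<in>S \<times> S. ?w f p * ?w g p)\<^sup>2 \<le>
      (\<Sum>p\<in>S \<times> S. ?w f p * ?w f p) * (\<Sum>p\<in>S \<times> S. ?w g p * ?w g p)"
    using Cauchy_Schwarz_ineq_sum[of "?w f" "?w g" "S \<times> S"] by (simp only: power2_eq_square)
  then show ?thesis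
    unfolding eq[OF S(2)] eq[OF S(3)] power_divide times_divide_times_eq
    by (simp only: power2_eq_square divide_right_mono)
qed

text \<open>The parallelogram law for \<open>f - g\<close> and \<open>g\<close>, with the energy of
  their difference dropped.\<close>

lemma dirichlet_form_le_diff:
  assumes "f \<in> finite_jump_algebra E" "g \<in> finite_jump_algebra E"
  shows "dirichlet_form f f \<le> 2 * dirichlet_form (f - g) (f - g) + 2 * dirichlet_form g g"
proof -
  have "0 \<le> dirichlet_form (f - g - g) (f - g - g)"
    by (intro dirichlet_form_nonneg finite_jump_algebra_diff assms)
  also have "\<dots> = 2 * dirichlet_form (f - g) (f - g) + 2 * dirichlet_form g g - dirichlet_form f f"
    using assms finite_jump_algebra_diff[OF assms]
    by (simp add: dirichlet_form_diff_left dirichlet_form_diff_right dirichlet_form_commute[of g f] algebra_simps)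
  finally show ?thesis by simp
qed

text \<open>Only finitely many values of the second argument enter, so pointwise convergence
  suffices.\<close>

lemma tendsto_dirichlet_form:
  assumes "f \<in> finite_jump_algebra E" "\<And>v. (\<lambda>n. G n v) \<longlonglongrightarrow> g v"
  shows "(\<lambda>n. dirichlet_form f (G n)) \<longlonglongrightarrow> dirichlet_form f g"
  unfolding dirichlet_form_eq[OF finite_jump_vertices[OF assms(1)] order_refl]
  by (intro tendsto_intros assms(2)) auto

section \<open>Differences of values bounded by energy and distance\<close>

text \<open>Cutting out the loop between two visits to a vertex shortens the list and removes a
  nonnegative length.\<close>

lemma distinct_path_exists:
  assumes "finite_path E u p v"
  obtains q where "finite_path E u q v" "distinct q" "path_length R q \<le> path_length R p"
proof -
  have "\<exists>q. finite_path E u q v \<and> distinct q \<and> path_length R q \<le> path_length R p"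
    using assms
  proof (induction "length p" arbitrary: p rule: less_induct)
    case less
    show ?case
    proof (cases "distinct p")
      case False
      then obtain a y b c where p: "p = a @ [y] @ b @ [y] @ c"
        using not_distinct_decomp by blast
      have start: "finite_path E u (a @ [y]) y"
        using less.prems unfolding p by (rule finite_path_takeD)
      have rest: "finite_path E y (y # b @ [y] @ c) v"
        using less.prems unfolding p by (rule finite_path_dropD)
      have "finite_path E y (y # c) v"
        by (rule finite_path_dropD[of E y "y # b" y c v]) (use rest in simp)
      with start have short: "finite_path E u (a @ [y] @ c) v"
        using finite_path_append by fastforce
      from rest have "finite_path E y ((y # b) @ [y]) y"
        by (intro finite_path_takeD[where q = c and v = v]) simp
      then have "0 \<le> path_length R ((y # b) @ [y])" by (rule path_length_nonneg)
      then have "path_length R (a @ [y] @ c) \<le> path_length R p"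
        unfolding p using path_length_append[of R a y c] path_length_append[of R a y "b @ [y] @ c"]
          path_length_append[of R "y # b" y c] by simp
      with less.hyps[OF _ short] p show ?thesis by fastforce
    qed (use less.prems in blast)
  qed
  with that show ?thesis by blast
qed

text \<open>Telescope \<open>f\<close> along the path and apply Cauchy-Schwarz with weights
  \<open>sqrt (r i)\<close>: one factor is the path length, the other the energy on the edges of the
  path. The factor 2 arises because the sum over ordered pairs is twice the form.\<close>

lemma square_diff_le_path_length:
  assumes f: "f \<in> finite_jump_algebra E" and p: "finite_path E u p v" "distinct p"
  shows "(f v - f u)\<^sup>2 \<le> path_length R p * (2 * dirichlet_form f f)"
proof -
  let ?c = "conductance E R"
  define n where "n = length p - 1"
  define d where "d i = f (p ! Suc i) - f (p ! i)" for i
  define r where "r i = R (p ! i) (p ! Suc i)" for i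
  \<comment> \<open>Adding the vertices of the path puts all its edges into
    \<open>S \<times> S\<close>.\<close>
  define S where "S = jump_vertices f \<union> set p"
  have S: "finite S" "jump_vertices f \<subseteq> S" using finite_jump_vertices[OF f] by (auto simp: S_def)
  have edge: "{p ! i, p ! Suc i} \<in> E" if "i < n" for i
    using p(1) that by (auto simp: finite_path_def n_def)
  have r: "0 < r i" if "i < n" for i
    unfolding r_def using edge[OF that] by (rule R_pos)
  have "f v - f u = (\<Sum>i<n. d i)"
    unfolding d_def using p(1) sum_lessThan_telescope[of "\<lambda>i. f (p ! i)" n]
    by (auto simp: finite_path_def n_def hd_conv_nth last_conv_nth)
  also have "\<dots> = (\<Sum>i<n. sqrt (r i) * (d i / sqrt (r i)))"
    using r by (intro sum.cong refl) fastforce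
  also have "\<dots>\<^sup>2 \<le> (\<Sum>i<n. (sqrt (r i))\<^sup>2) * (\<Sum>i<n. (d i / sqrt (r i))\<^sup>2)"
    by (rule Cauchy_Schwarz_ineq_sum)
  also have "(\<Sum>i<n. (sqrt (r i))\<^sup>2) = path_length R p"
    unfolding path_length_def n_def[symmetric] r_def[symmetric]
    using r by (intro sum.cong refl) (auto simp: less_imp_le)
  also have "(\<Sum>i<n. (d i / sqrt (r i))\<^sup>2) =
      (\<Sum>i<n. (\<lambda>(a, b). ?c a b * (f b - f a) * (f b - f a)) (p ! i, p ! Suc i))"
    using r edge by (intro sum.cong refl)
      (auto simp: conductance_def d_def r_def power_divide less_imp_le power2_eq_square)
  \<comment> \<open>Distinctness of the vertices makes the map from indices to oriented edges
    injective, so no edge is counted twice.\<close>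
  also have "\<dots> = (\<Sum>(a, b)\<in>(\<lambda>i. (p ! i, p ! Suc i)) ` {..<n}. ?c a b * (f b - f a) * (f b - f a))"
    using p(2) by (subst sum.reindex) (auto simp: inj_on_def n_def nth_eq_iff_index_eq)
  also have "\<dots> \<le> (\<Sum>(a, b)\<in>S \<times> S. ?c a b * (f b - f a) * (f b - f a))"
    by (rule sum_mono2) (use S(1) in \<open>auto simp: S_def n_def conductance_nonneg mult.assoc\<close>)
  also have "\<dots> = 2 * dirichlet_form f f"
    using dirichlet_form_eq_prod[OF S, of f] by simp
  finally show ?thesis
    using path_length_nonneg[OF p(1)] by (simp add: mult_left_mono)
qed

text \<open>The bound is linear in the path length, so the infimum over paths can be taken. Division
  by the energy requires it to be nonzero; with zero energy any single path already forces equal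
  values.\<close>

lemma square_diff_le_dist:
  assumes f: "f \<in> finite_jump_algebra E"
  shows "(f v - f u)\<^sup>2 \<le> 2 * dist (\<iota> u) (\<iota> v) * dirichlet_form f f"
proof -
  let ?D = "dirichlet_form f f"
  have bound: "(f v - f u)\<^sup>2 \<le> path_length R p * (2 * ?D)" if p: "finite_path E u p v" for p
  proof -
    obtain q where q: "finite_path E u q v" "distinct q" "path_length R q \<le> path_length R p"
      using distinct_path_exists[OF p] .
    have "path_length R q * (2 * ?D) \<le> path_length R p * (2 * ?D)"
      using q(3) dirichlet_form_nonneg[OF f] by (intro mult_right_mono) auto
    with square_diff_le_path_length[OF f q(1,2)] show ?thesis by linarith
  qed
  show ?thesis
  proof (cases "?D = 0")
    case True
    obtain p where "finite_path E u p v" using connected by (auto simp: graph_connected_def)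
    with True bound show ?thesis by fastforce
  next
    case False
    then have "0 < 2 * ?D" using dirichlet_form_nonneg[OF f] by auto
    then have "(f v - f u)\<^sup>2 / (2 * ?D) \<le> dist (\<iota> u) (\<iota> v)"
      by (intro le_dist_if_le_path_length) (simp add: bound pos_divide_le_eq)
    with \<open>0 < 2 * ?D\<close> show ?thesis by (simp add: pos_divide_le_eq mult_ac)
  qed
qed

section \<open>Closability and the Friedrichs extension\<close>

lemma l2_diff:
  assumes "f \<in> l2 \<mu>" "g \<in> l2 \<mu>"
  shows "f - g \<in> l2 \<mu>"
  unfolding l2_def mem_Collect_eq
proof (rule summable_on_comparison_test)
  show "(\<lambda>v. 2 * ((f v)\<^sup>2 * \<mu> v) + 2 * ((g v)\<^sup>2 * \<mu> v)) summable_on UNIV"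
    using assms unfolding l2_def by (intro summable_on_add summable_on_cmult_right) auto
  show "((f - g) v)\<^sup>2 * \<mu> v \<le> 2 * ((f v)\<^sup>2 * \<mu> v) + 2 * ((g v)\<^sup>2 * \<mu> v)" for v
  proof -
    have "((f - g) v)\<^sup>2 \<le> 2 * (f v)\<^sup>2 + 2 * (g v)\<^sup>2"
      using zero_le_power2[of "f v + g v"] by (simp add: power2_eq_square algebra_simps)
    then have "((f - g) v)\<^sup>2 * \<mu> v \<le> (2 * (f v)\<^sup>2 + 2 * (g v)\<^sup>2) * \<mu> v"
      using mu_pos[of v] by (intro mult_right_mono) auto
    then show ?thesis by (simp add: algebra_simps)
  qed
qed (use mu_pos in \<open>auto simp: less_imp_le\<close>)

lemma finite_support_l2:
  assumes "finite S" "\<And>v. v \<notin> S \<Longrightarrow> f v = 0"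
  shows "f \<in> l2 \<mu>"
proof -
  have "(\<lambda>v. (f v)\<^sup>2 * \<mu> v) summable_on S" using assms(1) by simp
  then show ?thesis
    unfolding l2_def mem_Collect_eq
    by (rule summable_on_cong_neutral[THEN iffD1, rotated -1]) (use assms(2) in auto)
qed

text \<open>One term of a nonnegative sum is at most the whole sum; thus evaluation at a vertex is
  continuous.\<close>

lemma abs_le_l2_norm:
  assumes "f \<in> l2 \<mu>"
  shows "\<bar>f v\<bar> * sqrt (\<mu> v) \<le> l2_norm \<mu> f"
proof -
  have "(\<Sum>v\<in>{v}. (f v)\<^sup>2 * \<mu> v) \<le> (\<Sum>\<^sub>\<infinity>v. (f v)\<^sup>2 * \<mu> v)"
    by (rule finite_sum_le_infsum) (use assms mu_pos in \<open>auto simp: l2_def less_imp_le\<close>)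
  then have "sqrt ((f v)\<^sup>2 * \<mu> v) \<le> l2_norm \<mu> f"
    by (simp add: l2_norm_def l2_inner_def power2_eq_square)
  then show ?thesis by (simp add: real_sqrt_mult)
qed

lemma l2_tendsto_pointwise:
  assumes "\<And>n. F n \<in> l2 \<mu>" "f \<in> l2 \<mu>" "(\<lambda>n. l2_norm \<mu> (F n - f)) \<longlonglongrightarrow> 0"
  shows "(\<lambda>n. F n v) \<longlonglongrightarrow> f v"
proof -
  have "(\<lambda>n. F n v - f v) \<longlonglongrightarrow> 0"
  proof (rule Lim_null_comparison)
    show "\<forall>\<^sub>F n in sequentially. norm (F n v - f v) \<le> l2_norm \<mu> (F n - f) / sqrt (\<mu> v)"
      using abs_le_l2_norm[OF l2_diff[OF assms(1,2)], of _ v] mu_pos[of v]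
      by (simp add: pos_le_divide_eq)
    show "(\<lambda>n. l2_norm \<mu> (F n - f) / sqrt (\<mu> v)) \<longlonglongrightarrow> 0"
      using tendsto_divide_zero[OF assms(3)] .
  qed
  then show ?thesis by (rule LIM_zero_cancel)
qed

section \<open>Form approximations of the Laplace operator\<close>

lemma dom_laplace_op: "dom (laplace_op E R \<iota> \<mu> \<Omega>) = algebra_vanishing E \<iota> \<Omega> \<inter> l2 \<mu>"
  by (auto simp: laplace_op_def restrict_map_def dom_def)

lemma algebra_vanishing_diff:
  assumes "f \<in> algebra_vanishing E \<iota> \<Omega>" "g \<in> algebra_vanishing E \<iota> \<Omega>"
  shows "f - g \<in> algebra_vanishing E \<iota> \<Omega>"
proof -
  obtain \<phi> \<psi> where
    "continuous_on (graph_completion \<iota>) \<phi>" "\<forall>v. \<phi> (\<iota> v) = f v" "\<forall>x\<in>\<Omega>. \<phi> x = 0"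
    "continuous_on (graph_completion \<iota>) \<psi>" "\<forall>v. \<psi> (\<iota> v) = g v" "\<forall>x\<in>\<Omega>. \<psi> x = 0"
    using assms unfolding algebra_vanishing_def by auto
  then have "continuous_on (graph_completion \<iota>) (\<lambda>x. \<phi> x - \<psi> x) \<and>
      (\<forall>v. \<phi> (\<iota> v) - \<psi> (\<iota> v) = (f - g) v) \<and> (\<forall>x\<in>\<Omega>. \<phi> x - \<psi> x = 0)"
    by (auto intro: continuous_intros)
  with assms finite_jump_algebra_diff show ?thesis
    unfolding algebra_vanishing_def mem_Collect_eq by blast
qed

lemma op_form_laplace_op:
  "f \<in> dom (laplace_op E R \<iota> \<mu> \<Omega>) \<Longrightarrow> op_form \<mu> (laplace_op E R \<iota> \<mu> \<Omega>) f g = dirichlet_form f g"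
  unfolding dom_laplace_op by (simp add: op_form_def laplace_op_def dirichlet_form_def)

lemma dom_laplace_op_diff:
  "f \<in> dom (laplace_op E R \<iota> \<mu> \<Omega>) \<Longrightarrow> g \<in> dom (laplace_op E R \<iota> \<mu> \<Omega>) \<Longrightarrow>
    f - g \<in> dom (laplace_op E R \<iota> \<mu> \<Omega>)"
  unfolding dom_laplace_op using algebra_vanishing_diff l2_diff by auto

lemma dom_laplace_op_jumps:
  "f \<in> dom (laplace_op E R \<iota> \<mu> \<Omega>) \<Longrightarrow> f \<in> finite_jump_algebra E"
  unfolding dom_laplace_op algebra_vanishing_def by auto

lemma form_approxD:
  assumes "form_approx \<mu> (laplace_op E R \<iota> \<mu> \<Omega>) F f"
  shows "F n \<in> dom (laplace_op E R \<iota> \<mu> \<Omega>)" "F n \<in> finite_jump_algebra E"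
    and "\<epsilon> > 0 \<Longrightarrow> \<exists>N. \<forall>m\<ge>N. \<forall>n\<ge>N. dirichlet_form (F m - F n) (F m - F n) < \<epsilon>"
    and "f \<in> l2 \<mu> \<Longrightarrow> (\<lambda>n. F n v) \<longlonglongrightarrow> f v"
proof -
  show F: "F n \<in> dom (laplace_op E R \<iota> \<mu> \<Omega>)" for n
    using assms by (simp add: form_approx_def)
  then show "F n \<in> finite_jump_algebra E" by (rule dom_laplace_op_jumps)
  show "\<exists>N. \<forall>m\<ge>N. \<forall>n\<ge>N. dirichlet_form (F m - F n) (F m - F n) < \<epsilon>" if "\<epsilon> > 0"
    using assms that unfolding form_approx_def
    by (simp add: op_form_laplace_op[OF dom_laplace_op_diff[OF F F]])
  show "(\<lambda>n. F n v) \<longlonglongrightarrow> f v" if "f \<in> l2 \<mu>"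
    by (rule l2_tendsto_pointwise) (use F assms that in \<open>auto simp: dom_laplace_op form_approx_def\<close>)
qed

text \<open>Compare all late members with one fixed \<open>F N\<close> at form distance less than
  1.\<close>

lemma dirichlet_form_eventually_bounded:
  assumes "form_approx \<mu> (laplace_op E R \<iota> \<mu> \<Omega>) F f"
  obtains M where "\<forall>\<^sub>F n in sequentially. dirichlet_form (F n) (F n) \<le> M"
proof -
  note F = form_approxD[OF assms]
  obtain N where N: "\<And>m n. m \<ge> N \<Longrightarrow> n \<ge> N \<Longrightarrow> dirichlet_form (F m - F n) (F m - F n) < 1"
    using F(3)[of 1] by auto
  have "dirichlet_form (F n) (F n) \<le> 2 * 1 + 2 * dirichlet_form (F N) (F N)" if "n \<ge> N" for n
    using dirichlet_form_le_diff[OF F(2) F(2), of n N] N[OF that order_refl] by linarith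
  then show ?thesis using that eventually_sequentially by blast
qed

text \<open>
  Closability. For large \<open>n\<close> and \<open>m\<close> the form at \<open>H n - H m\<close> is small, while its cross term at
  \<open>H n\<close> and \<open>H m\<close> tends to \<open>0\<close> in \<open>m\<close>, because only finitely many values of \<open>H m\<close> enter.
\<close>

lemma dirichlet_form_closable:
  assumes H: "\<And>n. H n \<in> finite_jump_algebra E"
    and null: "\<And>v. (\<lambda>n. H n v) \<longlonglongrightarrow> 0"
    and Cauchy: "\<And>\<epsilon>. \<epsilon> > 0 \<Longrightarrow> \<exists>N. \<forall>m\<ge>N. \<forall>n\<ge>N. dirichlet_form (H m - H n) (H m - H n) < \<epsilon>"
  shows "(\<lambda>n. dirichlet_form (H n) (H n)) \<longlonglongrightarrow> 0"
proof (rule LIMSEQ_I)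
  fix r :: real assume "0 < r"
  then obtain N where N: "\<And>m n. m \<ge> N \<Longrightarrow> n \<ge> N \<Longrightarrow> dirichlet_form (H m - H n) (H m - H n) < r / 2"
    using Cauchy[of "r / 2"] by auto
  have "norm (dirichlet_form (H n) (H n) - 0) < r" if n: "n \<ge> N" for n
  proof -
    have "dirichlet_form (H n) (\<lambda>_. 0) = 0"
      by (simp add: dirichlet_form_def l2_inner_def)
    then have "(\<lambda>m. r / 2 + 2 * dirichlet_form (H n) (H m)) \<longlonglongrightarrow> r / 2 + 2 * 0"
      using tendsto_dirichlet_form[OF H null, of n] by (intro tendsto_intros) simp
    moreover have "dirichlet_form (H n) (H n) \<le> r / 2 + 2 * dirichlet_form (H n) (H m)" if m: "m \<ge> N" for m
    proof -
      have "dirichlet_form (H n - H m) (H n - H m) =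
          dirichlet_form (H n) (H n) - 2 * dirichlet_form (H n) (H m) + dirichlet_form (H m) (H m)"
        using H by (simp add: dirichlet_form_diff_left dirichlet_form_diff_right
            dirichlet_form_commute[of "H m" "H n"])
      then show ?thesis using N[OF n m] dirichlet_form_nonneg[OF H, of m] by linarith
    qed
    ultimately have "dirichlet_form (H n) (H n) \<le> r / 2 + 2 * 0"
      by (intro LIMSEQ_le_const) auto
    then show ?thesis using \<open>0 < r\<close> dirichlet_form_nonneg[OF H, of n] by simp
  qed
  then show "\<exists>N. \<forall>n\<ge>N. norm (dirichlet_form (H n) (H n) - 0) < r" by blast
qed

text \<open>Split the form at \<open>F n\<close> and \<open>G n\<close> into its values at
  \<open>F n - f\<close> and at \<open>f\<close>. The first part tends to 0 by Cauchy-Schwarz, since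
  the energy of \<open>F n - f\<close> does so by closability while that of \<open>G n\<close> stays
  bounded. The second converges because only finitely many values of \<open>G n\<close>
  enter.\<close>

lemma op_form_tendsto:
  assumes f: "f \<in> dom (laplace_op E R \<iota> \<mu> \<Omega>)" and g: "g \<in> l2 \<mu>"
    and F: "form_approx \<mu> (laplace_op E R \<iota> \<mu> \<Omega>) F f"
    and G: "form_approx \<mu> (laplace_op E R \<iota> \<mu> \<Omega>) G g"
  shows "(\<lambda>n. op_form \<mu> (laplace_op E R \<iota> \<mu> \<Omega>) (F n) (G n)) \<longlonglongrightarrow> dirichlet_form f g"
proof -
  note F' = form_approxD[OF F] and G' = form_approxD[OF G]
  have fJ: "f \<in> finite_jump_algebra E" using f by (rule dom_laplace_op_jumps)
  have fl2: "f \<in> l2 \<mu>" using f by (simp add: dom_laplace_op)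
  define H where "H n = F n - f" for n
  have H: "H n \<in> finite_jump_algebra E" for n
    unfolding H_def by (rule finite_jump_algebra_diff[OF F'(2) fJ])
  have "(\<lambda>n. H n v) \<longlonglongrightarrow> 0" for v
    unfolding H_def using F'(4)[OF fl2, of v] by (simp add: LIM_zero)
  \<comment> \<open>Subtracting the fixed \<open>f\<close> leaves differences unchanged, so
    \<open>H\<close> inherits the Cauchy property.\<close>
  moreover have "H m - H n = F m - F n" for m n
    by (simp add: H_def fun_eq_iff)
  ultimately have H0: "(\<lambda>n. dirichlet_form (H n) (H n)) \<longlonglongrightarrow> 0"
    by (intro dirichlet_form_closable[OF H]) (simp_all add: F'(3))
  obtain M where M: "\<forall>\<^sub>F n in sequentially. dirichlet_form (G n) (G n) \<le> M"
    using dirichlet_form_eventually_bounded[OF G] .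
  have "(\<lambda>n. (dirichlet_form (H n) (G n))\<^sup>2) \<longlonglongrightarrow> 0"
  proof (rule Lim_null_comparison)
    show "\<forall>\<^sub>F n in sequentially. norm ((dirichlet_form (H n) (G n))\<^sup>2) \<le> dirichlet_form (H n) (H n) * M"
      using M
    proof eventually_elim
      case (elim n)
      have "dirichlet_form (H n) (H n) * dirichlet_form (G n) (G n) \<le> dirichlet_form (H n) (H n) * M"
        by (rule mult_left_mono[OF elim dirichlet_form_nonneg[OF H]])
      with dirichlet_form_Cauchy_Schwarz[OF H G'(2), of n n] show ?case by simp
    qed
    show "(\<lambda>n. dirichlet_form (H n) (H n) * M) \<longlonglongrightarrow> 0"
      using tendsto_mult_left_zero[OF H0] .
  qed
  then have "(\<lambda>n. dirichlet_form (H n) (G n)) \<longlonglongrightarrow> 0" by simp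
  then have "(\<lambda>n. dirichlet_form (H n) (G n) + dirichlet_form f (G n)) \<longlonglongrightarrow> 0 + dirichlet_form f g"
    by (rule tendsto_add) (rule tendsto_dirichlet_form[OF fJ G'(4)[OF g]])
  then show ?thesis
    using F'(2) fJ by (simp add: op_form_laplace_op[OF F'(1)] H_def dirichlet_form_diff_left)
qed

lemma dom_laplace_op_form_approx:
  assumes "f \<in> dom (laplace_op E R \<iota> \<mu> \<Omega>)"
  shows "form_approx \<mu> (laplace_op E R \<iota> \<mu> \<Omega>) (\<lambda>_. f) f"
  using op_form_laplace_op[OF dom_laplace_op_diff[OF assms assms]] assms
  unfolding form_approx_def
  by (simp add: l2_norm_def l2_inner_def dirichlet_form_def)

text \<open>The Laplacian of \<open>f\<close> has finite support, hence is square summable, and it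
  represents the closed form at \<open>f\<close> because \<open>op_form_tendsto\<close> identifies
  every limit in \<open>closed_form\<close>.\<close>

lemma dom_laplace_op_subset_friedrichs:
  "dom (laplace_op E R \<iota> \<mu> \<Omega>) \<subseteq> dom (friedrichs_laplacian E R \<iota> \<mu> \<Omega>)"
proof
  fix f assume f: "f \<in> dom (laplace_op E R \<iota> \<mu> \<Omega>)"
  let ?T = "laplace_op E R \<iota> \<mu> \<Omega>"
  have fl2: "f \<in> l2 \<mu>" using f by (simp add: dom_laplace_op)
  have "form_represents \<mu> ?T f (laplacian E R \<mu> f)"
    unfolding form_represents_def
  proof (intro conjI ballI)
    show "f \<in> closed_form_dom \<mu> ?T"
      using dom_laplace_op_form_approx[OF f] fl2 by (auto simp: closed_form_dom_def)
    show "laplacian E R \<mu> f \<in> l2 \<mu>"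
      using finite_jump_vertices[OF dom_laplace_op_jumps[OF f]] laplacian_outside
      by (rule finite_support_l2)
    fix g assume "g \<in> closed_form_dom \<mu> ?T"
    then obtain G where G: "g \<in> l2 \<mu>" "form_approx \<mu> ?T G g" by (auto simp: closed_form_dom_def)
    have "closed_form \<mu> ?T f g = dirichlet_form f g"
      unfolding closed_form_def
    proof (rule the_equality)
      show "\<forall>F G. form_approx \<mu> ?T F f \<and> form_approx \<mu> ?T G g \<longrightarrow>
          (\<lambda>n. op_form \<mu> ?T (F n) (G n)) \<longlonglongrightarrow> dirichlet_form f g"
        using op_form_tendsto[OF f G(1)] by blast
      \<comment> \<open>The constant sequence \<open>f\<close> together with \<open>G\<close> is one
        pair of approximations along which both limits must agree.\<close>
      show "c = dirichlet_form f g"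
        if "\<forall>F G. form_approx \<mu> ?T F f \<and> form_approx \<mu> ?T G g \<longrightarrow>
          (\<lambda>n. op_form \<mu> ?T (F n) (G n)) \<longlonglongrightarrow> c" for c
        using that dom_laplace_op_form_approx[OF f] G op_form_tendsto[OF f] LIMSEQ_unique by blast
    qed
    then show "closed_form \<mu> ?T f g = l2_inner \<mu> (laplacian E R \<mu> f) g"
      by (simp add: dirichlet_form_def)
  qed
  then show "f \<in> dom (friedrichs_laplacian E R \<iota> \<mu> \<Omega>)"
    by (auto simp: friedrichs_laplacian_def friedrichs_extension_def)
qed

lemma dom_friedrichs_subset:
  "dom (friedrichs_laplacian E R \<iota> \<mu> \<Omega>) \<subseteq> closed_form_dom \<mu> (laplace_op E R \<iota> \<mu> \<Omega>)"
  by (auto simp: friedrichs_laplacian_def friedrichs_extension_def form_represents_def split: if_splits)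

section \<open>Decay at boundary points\<close>

text \<open>Apply the distance bound to \<open>v\<close> and vertices \<open>w n\<close> tending to
  \<open>x\<close>; continuity of the extension sends \<open>f (w n)\<close> to 0.\<close>

lemma vanishing_square_le:
  assumes f: "f \<in> algebra_vanishing E \<iota> \<Omega>" and x: "x \<in> \<Omega>" "x \<in> graph_completion \<iota>"
  shows "(f v)\<^sup>2 \<le> 2 * dist (\<iota> v) x * dirichlet_form f f"
proof -
  obtain \<psi> where \<psi>: "continuous_on (graph_completion \<iota>) \<psi>" "\<And>v. \<psi> (\<iota> v) = f v" "\<psi> x = 0"
    and fJ: "f \<in> finite_jump_algebra E"
    using f x(1) unfolding algebra_vanishing_def by auto
  obtain s where s: "\<And>n. s n \<in> range \<iota>" "s \<longlonglongrightarrow> x"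
    using x(2) unfolding graph_completion_def closure_sequential by blast
  then have "\<forall>n. \<exists>w. s n = \<iota> w" by blast
  then obtain w where "\<forall>n. s n = \<iota> (w n)" by (rule choice[THEN exE])
  then have w: "s = (\<lambda>n. \<iota> (w n))" by auto
  have "(\<lambda>n. \<psi> (\<iota> (w n))) \<longlonglongrightarrow> \<psi> x"
    by (rule continuous_on_tendsto_compose[OF \<psi>(1)])
      (use s(2) x(2) closure_subset[of "range \<iota>"] in \<open>auto simp: w graph_completion_def intro!: always_eventually\<close>)
  then have "(\<lambda>n. (f v - f (w n))\<^sup>2) \<longlonglongrightarrow> (f v - 0)\<^sup>2"
    unfolding \<psi> by (intro tendsto_intros)
  moreover have "(\<lambda>n. 2 * dist (\<iota> v) (\<iota> (w n)) * dirichlet_form f f) \<longlonglongrightarrow> 2 * dist (\<iota> v) x * dirichlet_form f f"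
    using s(2) unfolding w by (intro tendsto_intros)
  moreover have "(f v - f (w n))\<^sup>2 \<le> 2 * dist (\<iota> v) (\<iota> (w n)) * dirichlet_form f f" for n
    using square_diff_le_dist[OF fJ, of v "w n"] by (simp add: dist_commute)
  ultimately have "(f v - 0)\<^sup>2 \<le> 2 * dist (\<iota> v) x * dirichlet_form f f"
    by (intro LIMSEQ_le) auto
  then show ?thesis by simp
qed

text \<open>The bound on the operator domain involves the function only through its energy, which
  stays bounded along an approximation, so it survives the pointwise limit.\<close>

lemma closed_form_dom_square_le:
  assumes f: "f \<in> closed_form_dom \<mu> (laplace_op E R \<iota> \<mu> \<Omega>)"
    and x: "x \<in> \<Omega>" "x \<in> graph_completion \<iota>"
  obtains M where "\<And>v. (f v)\<^sup>2 \<le> M * dist (\<iota> v) x"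
proof -
  obtain F where fl2: "f \<in> l2 \<mu>" and F: "form_approx \<mu> (laplace_op E R \<iota> \<mu> \<Omega>) F f"
    using f by (auto simp: closed_form_dom_def)
  obtain M where M: "\<forall>\<^sub>F n in sequentially. dirichlet_form (F n) (F n) \<le> M"
    using dirichlet_form_eventually_bounded[OF F] .
  have "(f v)\<^sup>2 \<le> (2 * M) * dist (\<iota> v) x" for v
  proof (rule tendsto_upperbound)
    show "(\<lambda>n. (F n v)\<^sup>2) \<longlonglongrightarrow> (f v)\<^sup>2"
      using form_approxD(4)[OF F fl2] by (rule tendsto_power)
    show "\<forall>\<^sub>F n in sequentially. (F n v)\<^sup>2 \<le> (2 * M) * dist (\<iota> v) x"
      using M
    proof eventually_elim
      case (elim n)
      have "(F n v)\<^sup>2 \<le> 2 * dist (\<iota> v) x * dirichlet_form (F n) (F n)"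
        using form_approxD(1)[OF F] by (intro vanishing_square_le[OF _ x]) (auto simp: dom_laplace_op)
      also have "\<dots> \<le> 2 * dist (\<iota> v) x * M" using elim by (intro mult_left_mono) auto
      finally show ?case by (simp add: mult_ac)
    qed
  qed simp
  then show ?thesis by (rule that)
qed

section \<open>Indicator functions and the main theorem\<close>

lemma summable_on_finite_measure:
  assumes "vertex_measure \<iota> \<mu> U < \<infinity>"
  shows "\<mu> summable_on {v. \<iota> v \<in> U}"
proof (rule nonneg_bdd_above_summable_on)
  let ?m = "vertex_measure \<iota> \<mu> U"
  show "bdd_above (sum \<mu> ` {F. F \<subseteq> {v. \<iota> v \<in> U} \<and> finite F})"
  proof (rule bdd_aboveI2)
    fix F assume F: "F \<in> {F. F \<subseteq> {v. \<iota> v \<in> U} \<and> finite F}"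
    then have "ennreal (sum \<mu> F) = (\<Sum>\<^sub>\<infinity>v\<in>F. ennreal (\<mu> v))"
      using mu_pos by (simp add: less_imp_le)
    also have "\<dots> \<le> ?m"
      unfolding vertex_measure_def by (rule infsum_mono_neutral) (use F in \<open>auto intro: nonneg_summable_on_complete\<close>)
    finally have "ennreal (sum \<mu> F) \<le> ennreal (enn2real ?m)"
      using assms by (simp add: less_top)
    then show "sum \<mu> F \<le> enn2real ?m" by (simp add: ennreal_le_iff)
  qed
qed (use mu_pos in \<open>auto simp: less_imp_le\<close>)

lemma indicator_l2:
  assumes "vertex_measure \<iota> \<mu> U < \<infinity>" "\<iota> ` A \<subseteq> U"
  shows "indicator A \<in> l2 \<mu>"
proof -
  have "\<mu> summable_on A"
    by (rule summable_on_subset[OF summable_on_finite_measure[OF assms(1)]]) (use assms(2) in auto)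
  then show ?thesis
    unfolding l2_def mem_Collect_eq
    by (rule summable_on_cong_neutral[THEN iffD1, rotated -1]) (auto simp: indicator_def)
qed

text \<open>A path shorter than all boundary edges cannot cross the boundary, so vertices inside and
  outside \<open>A\<close> keep a positive distance. The closures of the two vertex sets are
  therefore disjoint and cover the completion, and the indicator of one of them is a continuous
  extension.\<close>

lemma indicator_algebra_vanishing:
  assumes fin: "finite (edge_boundary A)" and \<Omega>: "\<Omega> \<subseteq> graph_completion \<iota>"
    and far: "\<And>y. y \<in> \<Omega> \<Longrightarrow> \<exists>e>0. \<forall>v. dist (\<iota> v) y < e \<longrightarrow> v \<notin> A"
  shows "indicator A \<in> algebra_vanishing E \<iota> \<Omega>"
proof -
  \<comment> \<open>Edges are unordered, so it does not matter which of the two named ends lies in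
    \<open>A\<close>.\<close>
  have bd: "{u, v} \<in> edge_boundary A" if "{u, v} \<in> E" "u \<in> A \<longleftrightarrow> v \<notin> A" for u v
  proof (cases "u \<in> A")
    case True
    with that show ?thesis unfolding edge_boundary_def by blast
  next
    case False
    with that have "{u, v} = {v, u}" "v \<in> A" by auto
    with False that show ?thesis unfolding edge_boundary_def by blast
  qed
  then have "{e \<in> E. \<exists>u v. e = {u, v} \<and> (indicator A u :: real) \<noteq> indicator A v} \<subseteq> edge_boundary A"
  proof clarify
    fix u v assume "{u, v} \<in> E" "(indicator A u :: real) \<noteq> indicator A v"
    then show "{u, v} \<in> edge_boundary A" by (intro bd) (auto simp: indicator_def split: if_splits)
  qed
  then have jumps: "(indicator A :: 'v \<Rightarrow> real) \<in> finite_jump_algebra E"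
    unfolding finite_jump_algebra_def using fin finite_subset by blast
  let ?K = "closure (\<iota> ` A)" and ?L = "closure (\<iota> ` (- A))"
  have "edge_boundary A \<subseteq> E" by (auto simp: edge_boundary_def)
  then obtain \<delta> where \<delta>: "\<delta> > 0" "\<And>u p v. finite_path E u p v \<Longrightarrow> path_length R p < \<delta> \<Longrightarrow>
      finite_path (E - edge_boundary A) u p v"
    using short_paths_avoid[OF fin] by blast
  have same: "u \<in> A \<longleftrightarrow> v \<in> A" if p: "finite_path (E - edge_boundary A) u p v" for u p v
    using p
  proof (induction p arbitrary: u)
    case (Cons a p)
    show ?case
    proof (cases p)
      case (Cons b q)
      then have "{a, b} \<in> E - edge_boundary A" "finite_path (E - edge_boundary A) b p v" "a = u"
        using Cons.prems by (auto simp: finite_path_iff_successively)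
      moreover from this(1) have "a \<in> A \<longleftrightarrow> b \<in> A" using bd by blast
      ultimately show ?thesis using Cons.IH by blast
    qed (use Cons.prems in \<open>auto simp: finite_path_def\<close>)
  qed (simp add: finite_path_def)
  have close: "u \<in> A \<longleftrightarrow> v \<in> A" if uv: "dist (\<iota> u) (\<iota> v) < \<delta>" for u v
    by (rule short_path_exists[OF uv]) (rule same[OF \<delta>(2)])
  have disj: "?K \<inter> ?L = {}"
  proof (rule ccontr)
    assume "?K \<inter> ?L \<noteq> {}"
    then obtain z where z: "z \<in> ?K" "z \<in> ?L" by auto
    have "\<delta> / 2 > 0" using \<delta>(1) by simp
    then obtain u v where uv: "u \<in> A" "dist (\<iota> u) z < \<delta> / 2" "v \<notin> A" "dist (\<iota> v) z < \<delta> / 2"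
      using z unfolding closure_approachable by (metis ComplD imageE)
    then have "dist (\<iota> u) (\<iota> v) < \<delta>" using dist_triangle2[of "\<iota> u" "\<iota> v" z] by linarith
    with uv close show False by blast
  qed
  have "range \<iota> = \<iota> ` A \<union> \<iota> ` (- A)" by auto
  then have compl: "graph_completion \<iota> = ?K \<union> ?L"
    unfolding graph_completion_def by (simp only: closure_Un)
  let ?\<psi> = "\<lambda>z. if z \<in> ?K then 1 else 0 :: real"
  have "continuous_on (graph_completion \<iota>) ?\<psi>"
    unfolding compl by (rule continuous_on_cases) (use disj in auto)
  moreover have "?\<psi> (\<iota> v) = indicator A v" for v
    using closure_subset[of "\<iota> ` A"] closure_subset[of "\<iota> ` (- A)"] disj by (auto simp: indicator_def)
  moreover have "?\<psi> x = 0" if "x \<in> \<Omega>" for x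
    using far[OF that] by (auto simp: closure_approachable)
  ultimately show ?thesis
    unfolding algebra_vanishing_def using jumps by blast
qed

text \<open>A one-sided version: whichever of two distinct sets has a point outside the other can
  play the role of \<open>\<Omega>\<close>.\<close>

theorem friedrichs_laplacian_dom_not_subset:
  assumes wc: "weakly_connected E \<iota>" and cpt: "compact (graph_completion \<iota>)"
    and \<Omega>: "\<Omega> \<subseteq> graph_completion \<iota> - range \<iota>"
    and \<Omega>': "compact \<Omega>'" "\<Omega>' \<subseteq> graph_completion \<iota>"
    and r: "r > 0" "vertex_measure \<iota> \<mu> (neighborhood \<iota> r \<Omega>) < \<infinity>"
    and x: "x \<in> \<Omega>" "x \<notin> \<Omega>'"
  shows "\<not> dom (friedrichs_laplacian E R \<iota> \<mu> \<Omega>') \<subseteq> dom (friedrichs_laplacian E R \<iota> \<mu> \<Omega>)"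
proof
  assume sub: "dom (friedrichs_laplacian E R \<iota> \<mu> \<Omega>') \<subseteq> dom (friedrichs_laplacian E R \<iota> \<mu> \<Omega>)"
  have xG: "x \<in> graph_completion \<iota> - range \<iota>" using \<Omega> x by auto
  \<comment> \<open>Besides \<open>\<Omega>'\<close>, the set \<open>A\<close> has to avoid all
    points at distance at least \<open>r\<close> from \<open>\<Omega>\<close>; this confines it to
    the neighbourhood of finite measure. The point \<open>x\<close> is at distance 0 from
    \<open>\<Omega>\<close>, hence not in \<open>K\<close>.\<close>
  define K where "K = \<Omega>' \<union> (graph_completion \<iota> \<inter> {z. r \<le> infdist z \<Omega>})"
  have "compact K"
    unfolding K_def by (intro compact_Un \<Omega>' compact_Int_closed cpt closed_Collect_le continuous_intros)
  moreover have "K \<subseteq> graph_completion \<iota>" "x \<notin> K"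
    using \<Omega>' x r by (auto simp: K_def)
  ultimately obtain A \<delta> where A: "\<delta> > 0" "finite (edge_boundary A)"
    "\<And>v. dist (\<iota> v) x < \<delta> \<Longrightarrow> v \<in> A"
    "\<And>y. y \<in> K \<Longrightarrow> \<exists>e>0. \<forall>v. dist (\<iota> v) y < e \<longrightarrow> v \<notin> A"
    by (rule separate_compact[OF wc xG]) (rule that)
  have G: "\<iota> v \<in> graph_completion \<iota>" for v
    using closure_subset[of "range \<iota>"] by (auto simp: graph_completion_def)
  \<comment> \<open>A vertex in \<open>K\<close> would lie within its own exclusion radius.\<close>
  have "\<iota> v \<notin> K" if "v \<in> A" for v
    using A(4)[of "\<iota> v"] that by (metis dist_self)
  then have "infdist (\<iota> v) \<Omega> \<le> r" if "v \<in> A" for v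
    using that G[of v] by (fastforce simp: K_def)
  then have "\<iota> ` A \<subseteq> neighborhood \<iota> r \<Omega>"
    using x(1) G by (auto simp: neighborhood_def)
  then have "indicator A \<in> dom (laplace_op E R \<iota> \<mu> \<Omega>')"
    unfolding dom_laplace_op using r(2) A(2,4) \<Omega>'(2)
    by (auto simp: K_def intro!: indicator_l2 indicator_algebra_vanishing)
  then have "indicator A \<in> closed_form_dom \<mu> (laplace_op E R \<iota> \<mu> \<Omega>)"
    using dom_laplace_op_subset_friedrichs sub dom_friedrichs_subset by blast
  then obtain M where M: "\<And>v. (indicator A v)\<^sup>2 \<le> M * dist (\<iota> v) x"
    using closed_form_dom_square_le[OF _ x(1)] xG by blast
  \<comment> \<open>Within \<open>\<delta>\<close> of \<open>x\<close> the indicator equals 1; the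
    second bound makes \<open>M * dist (\<iota> v) x\<close> less than 1. Adding 1 to
    \<open>\<bar>M\<bar>\<close> keeps the denominator positive.\<close>
  define e where "e = min \<delta> (1 / (\<bar>M\<bar> + 1))"
  have "e > 0" using A(1) by (simp add: e_def)
  then obtain v where v: "dist (\<iota> v) x < e"
    using xG unfolding graph_completion_def Diff_iff closure_approachable by (metis imageE)
  then have "1 \<le> M * dist (\<iota> v) x"
    using M[of v] A(3)[of v] by (simp add: e_def)
  also have "\<dots> \<le> (\<bar>M\<bar> + 1) * dist (\<iota> v) x" by (intro mult_right_mono) auto
  also have "\<dots> < 1" using v by (simp add: e_def pos_less_divide_eq mult.commute)
  finally show False by simp
qed

end

theorem theorem4p6:
  fixes E :: "'v::countable set set"
    and R :: "'v \<Rightarrow> 'v \<Rightarrow> real"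
    and \<iota> :: "'v \<Rightarrow> 'x::complete_space"
    and \<mu> :: "'v \<Rightarrow> real"
    and \<Omega>1 \<Omega>2 :: "'x set"
  assumes "edge_weighted_graph E R"
    and "graph_connected E"
    and "\<And>v. 0 < \<mu> v"
    and "isometric_map E R \<iota>"
    and "weakly_connected E \<iota>"
    and "compact (graph_completion \<iota>)"
    and "compact \<Omega>1" and "\<Omega>1 \<subseteq> graph_completion \<iota> - range \<iota>"
    and "compact \<Omega>2" and "\<Omega>2 \<subseteq> graph_completion \<iota> - range \<iota>"
    and "\<exists>r>0. vertex_measure \<iota> \<mu> (neighborhood \<iota> r \<Omega>1) < \<infinity>"
    and "\<exists>r>0. vertex_measure \<iota> \<mu> (neighborhood \<iota> r \<Omega>2) < \<infinity>"
    and "\<Omega>1 \<noteq> \<Omega>2"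
  shows "dom (friedrichs_laplacian E R \<iota> \<mu> \<Omega>1) \<noteq> dom (friedrichs_laplacian E R \<iota> \<mu> \<Omega>2)"
proof -
  interpret edge_weighted_graph E R by fact
  interpret completed_graph E R \<iota> \<mu>
    using assms(2-4) by unfold_locales
  consider x where "x \<in> \<Omega>1" "x \<notin> \<Omega>2" | x where "x \<in> \<Omega>2" "x \<notin> \<Omega>1"
    using assms(13) by blast
  then show ?thesis
  proof cases
    case 1
    obtain r where r: "r > 0" "vertex_measure \<iota> \<mu> (neighborhood \<iota> r \<Omega>1) < \<infinity>"
      using assms(11) by auto
    have "\<Omega>2 \<subseteq> graph_completion \<iota>" using assms(10) by auto
    from friedrichs_laplacian_dom_not_subset[OF assms(5,6,8,9) this r 1] show ?thesis by auto
  next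
    case 2
    obtain r where r: "r > 0" "vertex_measure \<iota> \<mu> (neighborhood \<iota> r \<Omega>2) < \<infinity>"
      using assms(12) by auto
    have "\<Omega>1 \<subseteq> graph_completion \<iota>" using assms(8) by auto
    from friedrichs_laplacian_dom_not_subset[OF assms(5,6,10,7) this r 2] show ?thesis by auto
  qed
qed

end
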